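(* Let $\mathcal Z$ be a noetherian abelian category of finite homological dimension $n$ equipped with a tilting object $T$, and let $\mathcal T_i,\mathcal F_i$ be the subcategories of $\mathcal Z$ defined in the context. Given any $E\in\mathcal Z$, there is a unique filtration of $E$ in $\mathcal Z$ $$0=:E_0\subseteq E_1\subseteq E_2\subseteq\cdots\subseteq E_n\subseteq E_{n+1}:=E$$ such that for all $1\le i\le n+1$ we have $E_i\in\mathcal T_i$ and $E_i/E_{i-1}\in\mathcal T_i\cap\mathcal F_{i-1}$. Besides, the categories $\mathcal T_i\cap\mathcal F_{i-1}$ ($1\le i\le n+1$) are extension-closed and have pairwise trivial intersections (i.e. the intersection of any two of them, for distinct indices, contains only zero objects).
   Context: Homological dimension $n$ means $\mathrm{Ext}^i_{\mathcal Z}(E,F)=0$ for all $E,F\in\mathcal Z$ and all $i\notin[0,n]$. $D(-)$ denotes the bounded derived category. That $T\in\mathcal Z$ is a tilting object means: $\mathrm{Ext}^i_{\mathcal Z}(T,T)=0$ for all $i\ne0$, and, with $A=\mathrm{Hom}_{\mathcal Z}(T,T)$ and $\mathcal A$ the abelian category of finitely generated right $A$-modules, the derived functor $\Phi:=R\mathrm{Hom}(T,-)$ is an equivalence $D(\mathcal Z)\to D(\mathcal A)$. For $E\in\mathcal Z$, $\Phi^i(E):=H^i(\Phi(E))$, which is $\mathrm{Ext}^i_{\mathcal Z}(T,E)$. Put $\mathcal B_i:=\{E\in\mathcal Z:\Phi^i(E)=0\}$. For a full subcategory $S\subseteq\mathcal Z$, $[S]$ denotes the extension-closure in $\mathcal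 Z$ of the class of all quotients in $\mathcal Z$ of objects of $S$, i.e. the objects admitting a finite filtration all of whose factors are quotients of objects of $S$. For $\mathcal V\subseteq\mathcal Z$, $\mathcal V^\circ:=\{E\in\mathcal Z:\mathrm{Hom}_{\mathcal Z}(V,E)=0\ \forall V\in\mathcal V\}$. For $1\le i\le n$: $\mathcal T_i:=[\mathcal B_i\cap\cdots\cap\mathcal B_{n-1}\cap\mathcal B_n]$ and $\mathcal F_i:=\mathcal T_i^\circ$. Also $\mathcal T_{n+1}:=\mathcal Z$, $\mathcal F_{n+1}:=\{0\}$, and by convention $\mathcal F_0:=\mathcal Z$ (so $\mathcal T_1\cap\mathcal F_0=\mathcal T_1$). *)

theory Defs
  imports "HOL-Algebra.Module"
begin

section \<open>Categories, functors, natural transformations\<close>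

text \<open>
  All categories are small: objects and arrows form sets in some types. An arrow determines its
  source and target, and \<open>g \<cdot>\<^bsub>C\<^esub> f\<close> is \<open>g\<close> after \<open>f\<close>; its value is irrelevant when
  \<open>src C g \<noteq> tgt C f\<close>.
\<close>

record ('o, 'm) precat =
  objs :: "'o set"
  arrs :: "'m set"
  src :: "'m \<Rightarrow> 'o"
  tgt :: "'m \<Rightarrow> 'o"
  idt :: "'o \<Rightarrow> 'm"
  cmp :: "'m \<Rightarrow> 'm \<Rightarrow> 'm" (infixr "\<cdot>\<index>" 75)

definition Hom :: "('o, 'm, 'x) precat_scheme \<Rightarrow> 'o \<Rightarrow> 'o \<Rightarrow> 'm set" where
  "Hom C X Y = {f \<in> arrs C. src C f = X \<and> tgt C f = Y}"

locale category =
  fixes C :: "('o, 'm, 'x) precat_scheme" (structure)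
  assumes src_obj: "f \<in> arrs C \<Longrightarrow> src C f \<in> objs C"
    and tgt_obj: "f \<in> arrs C \<Longrightarrow> tgt C f \<in> objs C"
    and idt_hom: "X \<in> objs C \<Longrightarrow> idt C X \<in> Hom C X X"
    and cmp_hom: "f \<in> Hom C X Y \<Longrightarrow> g \<in> Hom C Y W \<Longrightarrow> g \<cdot> f \<in> Hom C X W"
    and idt_left: "f \<in> Hom C X Y \<Longrightarrow> idt C Y \<cdot> f = f"
    and idt_right: "f \<in> Hom C X Y \<Longrightarrow> f \<cdot> idt C X = f"
    and cmp_assoc: "f \<in> Hom C X Y \<Longrightarrow> g \<in> Hom C Y W \<Longrightarrow> h \<in> Hom C W V \<Longrightarrow>
      (h \<cdot> g) \<cdot> f = h \<cdot> (g \<cdot> f)"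

definition is_iso :: "('o, 'm, 'x) precat_scheme \<Rightarrow> 'm \<Rightarrow> bool" where
  "is_iso C f \<longleftrightarrow> f \<in> arrs C \<and>
     (\<exists>g \<in> Hom C (tgt C f) (src C f). g \<cdot>\<^bsub>C\<^esub> f = idt C (src C f) \<and> f \<cdot>\<^bsub>C\<^esub> g = idt C (tgt C f))"

definition is_mono :: "('o, 'm, 'x) precat_scheme \<Rightarrow> 'm \<Rightarrow> bool" where
  "is_mono C m \<longleftrightarrow> m \<in> arrs C \<and>
     (\<forall>W. \<forall>f \<in> Hom C W (src C m). \<forall>g \<in> Hom C W (src C m). m \<cdot>\<^bsub>C\<^esub> f = m \<cdot>\<^bsub>C\<^esub> g \<longrightarrow> f = g)"

definition is_epi :: "('o, 'm, 'x) precat_scheme \<Rightarrow> 'm \<Rightarrow> bool" where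
  "is_epi C e \<longleftrightarrow> e \<in> arrs C \<and>
     (\<forall>W. \<forall>f \<in> Hom C (tgt C e) W. \<forall>g \<in> Hom C (tgt C e) W. f \<cdot>\<^bsub>C\<^esub> e = g \<cdot>\<^bsub>C\<^esub> e \<longrightarrow> f = g)"

definition zero_object :: "('o, 'm, 'x) precat_scheme \<Rightarrow> 'o \<Rightarrow> bool" where
  "zero_object C X \<longleftrightarrow> X \<in> objs C \<and>
     (\<forall>Y \<in> objs C. (\<exists>!f. f \<in> Hom C X Y) \<and> (\<exists>!f. f \<in> Hom C Y X))"

record ('o, 'm, 'p, 'q) ftor =
  fo :: "'o \<Rightarrow> 'p"
  fm :: "'m \<Rightarrow> 'q"

definition is_functor ::
  "('o, 'm, 'x) precat_scheme \<Rightarrow> ('p, 'q, 'y) precat_scheme \<Rightarrow> ('o, 'm, 'p, 'q) ftor \<Rightarrow> bool" where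
  "is_functor C D F \<longleftrightarrow>
     (\<forall>X \<in> objs C. fo F X \<in> objs D \<and> fm F (idt C X) = idt D (fo F X)) \<and>
     (\<forall>f \<in> arrs C. fm F f \<in> Hom D (fo F (src C f)) (fo F (tgt C f))) \<and>
     (\<forall>f \<in> arrs C. \<forall>g \<in> arrs C. src C g = tgt C f \<longrightarrow> fm F (g \<cdot>\<^bsub>C\<^esub> f) = fm F g \<cdot>\<^bsub>D\<^esub> fm F f)"

definition id_ftor :: "('o, 'm, 'o, 'm) ftor" where
  "id_ftor = \<lparr>fo = id, fm = id\<rparr>"

definition comp_ftor ::
  "('p, 'q, 'r, 's) ftor \<Rightarrow> ('o, 'm, 'p, 'q) ftor \<Rightarrow> ('o, 'm, 'r, 's) ftor" where
  "comp_ftor G F = \<lparr>fo = fo G \<circ> fo F, fm = fm G \<circ> fm F\<rparr>"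

definition nat_trans ::
  "('o, 'm, 'x) precat_scheme \<Rightarrow> ('p, 'q, 'y) precat_scheme \<Rightarrow>
   ('o, 'm, 'p, 'q) ftor \<Rightarrow> ('o, 'm, 'p, 'q) ftor \<Rightarrow> ('o \<Rightarrow> 'q) \<Rightarrow> bool" where
  "nat_trans C D F G \<eta> \<longleftrightarrow>
     (\<forall>X \<in> objs C. \<eta> X \<in> Hom D (fo F X) (fo G X)) \<and>
     (\<forall>f \<in> arrs C. \<eta> (tgt C f) \<cdot>\<^bsub>D\<^esub> fm F f = fm G f \<cdot>\<^bsub>D\<^esub> \<eta> (src C f))"

definition nat_iso ::
  "('o, 'm, 'x) precat_scheme \<Rightarrow> ('p, 'q, 'y) precat_scheme \<Rightarrow>
   ('o, 'm, 'p, 'q) ftor \<Rightarrow> ('o, 'm, 'p, 'q) ftor \<Rightarrow> ('o \<Rightarrow> 'q) \<Rightarrow> bool" where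
  "nat_iso C D F G \<eta> \<longleftrightarrow> nat_trans C D F G \<eta> \<and> (\<forall>X \<in> objs C. is_iso D (\<eta> X))"

definition is_equivalence ::
  "('o, 'm, 'x) precat_scheme \<Rightarrow> ('p, 'q, 'y) precat_scheme \<Rightarrow> ('o, 'm, 'p, 'q) ftor \<Rightarrow> bool" where
  "is_equivalence C D F \<longleftrightarrow> is_functor C D F \<and>
     (\<exists>G \<eta> \<epsilon>. is_functor D C G \<and> nat_iso C C id_ftor (comp_ftor G F) \<eta> \<and>
        nat_iso D D (comp_ftor F G) id_ftor \<epsilon>)"


section \<open>Abelian categories\<close>

record ('o, 'm) preadd = "('o, 'm) precat" +
  addm :: "'m \<Rightarrow> 'm \<Rightarrow> 'm"
  zerom :: "'o \<Rightarrow> 'o \<Rightarrow> 'm"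

definition hom_grp :: "('o, 'm) preadd \<Rightarrow> 'o \<Rightarrow> 'o \<Rightarrow> 'm monoid" where
  "hom_grp C X Y = \<lparr>carrier = Hom C X Y, mult = addm C, one = zerom C X Y\<rparr>"

definition negm :: "('o, 'm) preadd \<Rightarrow> 'm \<Rightarrow> 'm" where
  "negm C f = inv\<^bsub>hom_grp C (src C f) (tgt C f)\<^esub> f"

locale preadditive_category = category C for C :: "('o, 'm) preadd" (structure) +
  assumes hom_comm_group: "X \<in> objs C \<Longrightarrow> Y \<in> objs C \<Longrightarrow> comm_group (hom_grp C X Y)"
    and add_cmp: "f \<in> Hom C X Y \<Longrightarrow> g \<in> Hom C Y W \<Longrightarrow> h \<in> Hom C Y W \<Longrightarrow>
      addm C g h \<cdot> f = addm C (g \<cdot> f) (h \<cdot> f)"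
    and cmp_add: "f \<in> Hom C X Y \<Longrightarrow> g \<in> Hom C X Y \<Longrightarrow> h \<in> Hom C Y W \<Longrightarrow>
      h \<cdot> addm C f g = addm C (h \<cdot> f) (h \<cdot> g)"

definition is_kernel :: "('o, 'm) preadd \<Rightarrow> 'm \<Rightarrow> 'm \<Rightarrow> bool" where
  "is_kernel C f k \<longleftrightarrow> f \<in> arrs C \<and> k \<in> arrs C \<and> tgt C k = src C f \<and>
     f \<cdot>\<^bsub>C\<^esub> k = zerom C (src C k) (tgt C f) \<and>
     (\<forall>g \<in> arrs C. tgt C g = src C f \<and> f \<cdot>\<^bsub>C\<^esub> g = zerom C (src C g) (tgt C f) \<longrightarrow>
        (\<exists>!u. u \<in> Hom C (src C g) (src C k) \<and> k \<cdot>\<^bsub>C\<^esub> u = g))"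

definition is_cokernel :: "('o, 'm) preadd \<Rightarrow> 'm \<Rightarrow> 'm \<Rightarrow> bool" where
  "is_cokernel C f q \<longleftrightarrow> f \<in> arrs C \<and> q \<in> arrs C \<and> src C q = tgt C f \<and>
     q \<cdot>\<^bsub>C\<^esub> f = zerom C (src C f) (tgt C q) \<and>
     (\<forall>g \<in> arrs C. src C g = tgt C f \<and> g \<cdot>\<^bsub>C\<^esub> f = zerom C (src C f) (tgt C g) \<longrightarrow>
        (\<exists>!u. u \<in> Hom C (tgt C q) (tgt C g) \<and> u \<cdot>\<^bsub>C\<^esub> q = g))"

definition is_biproduct ::
  "('o, 'm) preadd \<Rightarrow> 'o \<Rightarrow> 'o \<Rightarrow> 'o \<Rightarrow> 'm \<Rightarrow> 'm \<Rightarrow> 'm \<Rightarrow> 'm \<Rightarrow> bool" where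
  "is_biproduct C X Y B i1 i2 p1 p2 \<longleftrightarrow>
     i1 \<in> Hom C X B \<and> i2 \<in> Hom C Y B \<and> p1 \<in> Hom C B X \<and> p2 \<in> Hom C B Y \<and>
     p1 \<cdot>\<^bsub>C\<^esub> i1 = idt C X \<and> p2 \<cdot>\<^bsub>C\<^esub> i2 = idt C Y \<and>
     p1 \<cdot>\<^bsub>C\<^esub> i2 = zerom C Y X \<and> p2 \<cdot>\<^bsub>C\<^esub> i1 = zerom C X Y \<and>
     addm C (i1 \<cdot>\<^bsub>C\<^esub> p1) (i2 \<cdot>\<^bsub>C\<^esub> p2) = idt C B"

locale abelian_category = preadditive_category C for C :: "('o, 'm) preadd" (structure) +
  assumes ex_zero: "\<exists>X. zero_object C X"
    and ex_biproduct: "X \<in> objs C \<Longrightarrow> Y \<in> objs C \<Longrightarrow>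
      \<exists>B i1 i2 p1 p2. B \<in> objs C \<and> is_biproduct C X Y B i1 i2 p1 p2"
    and ex_kernel: "f \<in> arrs C \<Longrightarrow> \<exists>k. is_kernel C f k"
    and ex_cokernel: "f \<in> arrs C \<Longrightarrow> \<exists>q. is_cokernel C f q"
    and mono_normal: "is_mono C m \<Longrightarrow> \<exists>f. is_kernel C f m"
    and epi_normal: "is_epi C e \<Longrightarrow> \<exists>f. is_cokernel C f e"

definition short_exact :: "('o, 'm) preadd \<Rightarrow> 'm \<Rightarrow> 'm \<Rightarrow> bool" where
  "short_exact C f g \<longleftrightarrow> is_kernel C g f \<and> is_cokernel C f g"

definition ext_closed :: "('o, 'm) preadd \<Rightarrow> 'o set \<Rightarrow> bool" where
  "ext_closed C \<X> \<longleftrightarrow>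
     (\<forall>f g. short_exact C f g \<and> src C f \<in> \<X> \<and> tgt C g \<in> \<X> \<longrightarrow> tgt C f \<in> \<X>)"


section \<open>Subobjects, chains of subobjects, the operators \<open>[S]\<close> and \<open>V\<^sup>\<circ>\<close>\<close>

text \<open>A subobject of \<open>E\<close> is an equivalence class of monomorphisms into \<open>E\<close>.\<close>

definition mono_le :: "('o, 'm, 'x) precat_scheme \<Rightarrow> 'm \<Rightarrow> 'm \<Rightarrow> bool" where
  "mono_le C m m' \<longleftrightarrow> (\<exists>u \<in> Hom C (src C m) (src C m'). m = m' \<cdot>\<^bsub>C\<^esub> u)"

definition monos_into :: "('o, 'm, 'x) precat_scheme \<Rightarrow> 'o \<Rightarrow> 'm set" where
  "monos_into C E = {m. is_mono C m \<and> tgt C m = E}"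

definition subobj_of :: "('o, 'm, 'x) precat_scheme \<Rightarrow> 'm \<Rightarrow> 'm set" where
  "subobj_of C m = {m' \<in> monos_into C (tgt C m). mono_le C m m' \<and> mono_le C m' m}"

definition subobjs :: "('o, 'm, 'x) precat_scheme \<Rightarrow> 'o \<Rightarrow> 'm set set" where
  "subobjs C E = subobj_of C ` monos_into C E"

definition sub_le :: "('o, 'm, 'x) precat_scheme \<Rightarrow> 'm set \<Rightarrow> 'm set \<Rightarrow> bool" where
  "sub_le C S S' \<longleftrightarrow> (\<exists>m \<in> S. \<exists>m' \<in> S'. mono_le C m m')"

definition sub_bot :: "('o, 'm, 'x) precat_scheme \<Rightarrow> 'o \<Rightarrow> 'm set" where
  "sub_bot C E = {m \<in> monos_into C E. zero_object C (src C m)}"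

definition sub_top :: "('o, 'm, 'x) precat_scheme \<Rightarrow> 'o \<Rightarrow> 'm set" where
  "sub_top C E = subobj_of C (idt C E)"

text \<open>
  A subobject, and the factor of two nested subobjects, are objects only up to isomorphism;
  the following say that every representing object lies in the given class.
\<close>

definition sub_in :: "('o, 'm, 'x) precat_scheme \<Rightarrow> 'm set \<Rightarrow> 'o set \<Rightarrow> bool" where
  "sub_in C S \<X> \<longleftrightarrow> (\<forall>m \<in> S. src C m \<in> \<X>)"

definition factor_in :: "('o, 'm) preadd \<Rightarrow> 'm set \<Rightarrow> 'm set \<Rightarrow> 'o set \<Rightarrow> bool" where
  "factor_in C S' S \<X> \<longleftrightarrow>
     (\<forall>m' \<in> S'. \<forall>m \<in> S. \<forall>u \<in> Hom C (src C m') (src C m). \<forall>q.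
        m' = m \<cdot>\<^bsub>C\<^esub> u \<and> is_cokernel C u q \<longrightarrow> tgt C q \<in> \<X>)"

text \<open>Chains \<open>0 = S 0 \<le> S 1 \<le> \<dots> \<le> S k = E\<close>, extensional in the index.\<close>

definition sub_chain :: "('o, 'm, 'x) precat_scheme \<Rightarrow> 'o \<Rightarrow> nat \<Rightarrow> (nat \<Rightarrow> 'm set) \<Rightarrow> bool" where
  "sub_chain C E k S \<longleftrightarrow> S \<in> {0..k} \<rightarrow>\<^sub>E subobjs C E \<and> S 0 = sub_bot C E \<and> S k = sub_top C E \<and>
     (\<forall>i \<in> {1..k}. sub_le C (S (i - 1)) (S i))"

definition noetherian :: "('o, 'm, 'x) precat_scheme \<Rightarrow> bool" where
  "noetherian C \<longleftrightarrow> (\<forall>E \<in> objs C. \<forall>S :: nat \<Rightarrow> 'm set.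
     (\<forall>k. S k \<in> subobjs C E \<and> sub_le C (S k) (S (Suc k))) \<longrightarrow> (\<exists>N. \<forall>k \<ge> N. S k = S N))"

definition quotients :: "('o, 'm, 'x) precat_scheme \<Rightarrow> 'o set \<Rightarrow> 'o set" where
  "quotients C \<S> = {tgt C e | e. is_epi C e \<and> src C e \<in> \<S>}"

definition bracket :: "('o, 'm) preadd \<Rightarrow> 'o set \<Rightarrow> 'o set" where
  "bracket C \<S> = {E \<in> objs C. \<exists>k S. sub_chain C E k S \<and>
     (\<forall>i \<in> {1..k}. factor_in C (S (i - 1)) (S i) (quotients C \<S>))}"

definition right_orth :: "('o, 'm) preadd \<Rightarrow> 'o set \<Rightarrow> 'o set" where
  "right_orth C \<V> = {E \<in> objs C. \<forall>V \<in> \<V>. Hom C V E = {zerom C V E}}"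


section \<open>Bounded cochain complexes\<close>

record ('o, 'm) cpx =
  cob :: "int \<Rightarrow> 'o"
  cd :: "int \<Rightarrow> 'm"  \<comment> \<open>\<open>cd X i\<close> goes from degree \<open>i\<close> to degree \<open>i + 1\<close>\<close>

definition bcpx :: "('o, 'm) preadd \<Rightarrow> ('o, 'm) cpx set" where
  "bcpx C = {X. (\<forall>i. cob X i \<in> objs C \<and> cd X i \<in> Hom C (cob X i) (cob X (i + 1)) \<and>
                   cd X (i + 1) \<cdot>\<^bsub>C\<^esub> cd X i = zerom C (cob X i) (cob X (i + 2))) \<and>
                (\<exists>a b. \<forall>i. i < a \<or> b < i \<longrightarrow> zero_object C (cob X i))}"

definition chain_maps :: "('o, 'm) preadd \<Rightarrow> ('o, 'm) cpx \<Rightarrow> ('o, 'm) cpx \<Rightarrow> (int \<Rightarrow> 'm) set" where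
  "chain_maps C X Y = {f. \<forall>i. f i \<in> Hom C (cob X i) (cob Y i) \<and>
     cd Y i \<cdot>\<^bsub>C\<^esub> f i = f (i + 1) \<cdot>\<^bsub>C\<^esub> cd X i}"

definition comp_maps :: "('o, 'm) preadd \<Rightarrow> (int \<Rightarrow> 'm) \<Rightarrow> (int \<Rightarrow> 'm) \<Rightarrow> (int \<Rightarrow> 'm)" where
  "comp_maps C g f = (\<lambda>i. g i \<cdot>\<^bsub>C\<^esub> f i)"

definition id_map :: "('o, 'm) preadd \<Rightarrow> ('o, 'm) cpx \<Rightarrow> (int \<Rightarrow> 'm)" where
  "id_map C X = (\<lambda>i. idt C (cob X i))"

definition homotopic ::
  "('o, 'm) preadd \<Rightarrow> ('o, 'm) cpx \<Rightarrow> ('o, 'm) cpx \<Rightarrow> (int \<Rightarrow> 'm) \<Rightarrow> (int \<Rightarrow> 'm) \<Rightarrow> bool" where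
  "homotopic C X Y f g \<longleftrightarrow>
     (\<exists>h. \<forall>i. h i \<in> Hom C (cob X i) (cob Y (i - 1)) \<and>
        f i = addm C (g i) (addm C (cd Y (i - 1) \<cdot>\<^bsub>C\<^esub> h i) (h (i + 1) \<cdot>\<^bsub>C\<^esub> cd X i)))"

type_synonym ('o, 'm) cmap = "('o, 'm) cpx \<times> (int \<Rightarrow> 'm) \<times> ('o, 'm) cpx"

definition cpx_cat :: "('o, 'm) preadd \<Rightarrow> (('o, 'm) cpx, ('o, 'm) cmap) precat" where
  "cpx_cat C = \<lparr>objs = bcpx C,
     arrs = {(X, f, Y). X \<in> bcpx C \<and> Y \<in> bcpx C \<and> f \<in> chain_maps C X Y},
     src = (\<lambda>(X, f, Y). X), tgt = (\<lambda>(X, f, Y). Y), idt = (\<lambda>X. (X, id_map C X, X)),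
     cmp = (\<lambda>(Y, g, W) (X, f, Y'). (X, comp_maps C g f, W))\<rparr>"

definition shift_cpx :: "('o, 'm) preadd \<Rightarrow> int \<Rightarrow> ('o, 'm) cpx \<Rightarrow> ('o, 'm) cpx" where
  "shift_cpx C k X = \<lparr>cob = (\<lambda>i. cob X (i + k)),
     cd = (\<lambda>i. if even k then cd X (i + k) else negm C (cd X (i + k)))\<rparr>"

definition shift_map :: "int \<Rightarrow> (int \<Rightarrow> 'm) \<Rightarrow> (int \<Rightarrow> 'm)" where
  "shift_map k f = (\<lambda>i. f (i + k))"

definition stalk :: "('o, 'm) preadd \<Rightarrow> 'o \<Rightarrow> ('o, 'm) cpx" where
  "stalk C E = (let ob = (\<lambda>i::int. if i = 0 then E else (SOME N. zero_object C N))
     in \<lparr>cob = ob, cd = (\<lambda>i. zerom C (ob i) (ob (i + 1)))\<rparr>)"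

text \<open>
  \<open>cohom_data C X i k p\<close>: \<open>k\<close> is a kernel of \<open>d\<^sup>i\<close>, and \<open>p\<close> is a cokernel of the factorization of
  \<open>d\<^sup>i\<^sup>-\<^sup>1\<close> through \<open>k\<close>, so that the target of \<open>p\<close> is \<open>H\<^sup>i(X)\<close>.
\<close>

definition cohom_data ::
  "('o, 'm) preadd \<Rightarrow> ('o, 'm) cpx \<Rightarrow> int \<Rightarrow> 'm \<Rightarrow> 'm \<Rightarrow> bool" where
  "cohom_data C X i k p \<longleftrightarrow> is_kernel C (cd X i) k \<and>
     (\<exists>e \<in> Hom C (cob X (i - 1)) (src C k). k \<cdot>\<^bsub>C\<^esub> e = cd X (i - 1) \<and> is_cokernel C e p)"

definition cohomology :: "('o, 'm) preadd \<Rightarrow> ('o, 'm) cpx \<Rightarrow> int \<Rightarrow> 'o" where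
  "cohomology C X i = (SOME H. \<exists>k p. cohom_data C X i k p \<and> H = tgt C p)"

text \<open>In the following, \<open>\<psi>\<close> is the map induced by \<open>f\<close> on \<open>H\<^sup>i\<close>.\<close>

definition quasi_iso ::
  "('o, 'm) preadd \<Rightarrow> ('o, 'm) cpx \<Rightarrow> ('o, 'm) cpx \<Rightarrow> (int \<Rightarrow> 'm) \<Rightarrow> bool" where
  "quasi_iso C X Y f \<longleftrightarrow> f \<in> chain_maps C X Y \<and>
     (\<forall>i k p k' p' \<phi> \<psi>. cohom_data C X i k p \<and> cohom_data C Y i k' p' \<and>
        \<phi> \<in> Hom C (src C k) (src C k') \<and> k' \<cdot>\<^bsub>C\<^esub> \<phi> = f i \<cdot>\<^bsub>C\<^esub> k \<and>
        \<psi> \<in> Hom C (tgt C p) (tgt C p') \<and> \<psi> \<cdot>\<^bsub>C\<^esub> p = p' \<cdot>\<^bsub>C\<^esub> \<phi> \<longrightarrow> is_iso C \<psi>)"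


section \<open>The bounded derived category\<close>

text \<open>
  Objects are the bounded complexes. An arrow from \<open>X\<close> to \<open>Y\<close> is an equivalence class of roofs
  \<open>X \<leftarrow> W \<rightarrow> Y\<close>, written \<open>(W, s, f)\<close> with \<open>s : W \<rightarrow> X\<close> a quasi-isomorphism; that is, we use the
  calculus of fractions in the homotopy category.
\<close>

type_synonym ('o, 'm) roof = "('o, 'm) cpx \<times> (int \<Rightarrow> 'm) \<times> (int \<Rightarrow> 'm)"
type_synonym ('o, 'm) darr = "('o, 'm) cpx \<times> ('o, 'm) roof set \<times> ('o, 'm) cpx"

definition roofs :: "('o, 'm) preadd \<Rightarrow> ('o, 'm) cpx \<Rightarrow> ('o, 'm) cpx \<Rightarrow> ('o, 'm) roof set" where
  "roofs C X Y = {(W, s, f). W \<in> bcpx C \<and> quasi_iso C W X s \<and> f \<in> chain_maps C W Y}"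

definition roof_eq ::
  "('o, 'm) preadd \<Rightarrow> ('o, 'm) cpx \<Rightarrow> ('o, 'm) cpx \<Rightarrow> ('o, 'm) roof \<Rightarrow> ('o, 'm) roof \<Rightarrow> bool" where
  "roof_eq C X Y = (\<lambda>(W, s, f) (W', s', f').
     \<exists>V \<in> bcpx C. \<exists>u \<in> chain_maps C V W. \<exists>u' \<in> chain_maps C V W'.
       quasi_iso C V X (comp_maps C s u) \<and>
       homotopic C V X (comp_maps C s u) (comp_maps C s' u') \<and>
       homotopic C V Y (comp_maps C f u) (comp_maps C f' u'))"

definition roof_class ::
  "('o, 'm) preadd \<Rightarrow> ('o, 'm) cpx \<Rightarrow> ('o, 'm) cpx \<Rightarrow> ('o, 'm) roof \<Rightarrow> ('o, 'm) roof set" where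
  "roof_class C X Y \<rho> = {\<rho>' \<in> roofs C X Y. roof_eq C X Y \<rho> \<rho>'}"

text \<open>
  \<open>(W', t, g)\<close> after \<open>(W, s, f)\<close> is represented by every roof \<open>(V, s \<circ> r, g \<circ> h)\<close> with \<open>r : V \<rightarrow> W\<close> a
  quasi-isomorphism and \<open>h : V \<rightarrow> W'\<close> such that \<open>t \<circ> h\<close> and \<open>f \<circ> r\<close> are homotopic. All these roofs are
  equivalent, so the union below is a single class.
\<close>

definition roof_comp ::
  "('o, 'm) preadd \<Rightarrow> ('o, 'm) cpx \<Rightarrow> ('o, 'm) cpx \<Rightarrow> ('o, 'm) cpx \<Rightarrow>
   ('o, 'm) roof set \<Rightarrow> ('o, 'm) roof set \<Rightarrow> ('o, 'm) roof set" where
  "roof_comp C X Y Y' R' R = (\<Union>{roof_class C X Y' (V, comp_maps C s r, comp_maps C g h) |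
     V s r g h. \<exists>W f W' t. (W, s, f) \<in> R \<and> (W', t, g) \<in> R' \<and> V \<in> bcpx C \<and>
       quasi_iso C V W r \<and> h \<in> chain_maps C V W' \<and>
       homotopic C V Y (comp_maps C t h) (comp_maps C f r)})"

definition derived :: "('o, 'm) preadd \<Rightarrow> (('o, 'm) cpx, ('o, 'm) darr) precat" where
  "derived C = \<lparr>objs = bcpx C,
     arrs = {(X, roof_class C X Y \<rho>, Y) | X Y \<rho>. X \<in> bcpx C \<and> Y \<in> bcpx C \<and> \<rho> \<in> roofs C X Y},
     src = (\<lambda>(X, R, Y). X), tgt = (\<lambda>(X, R, Y). Y),
     idt = (\<lambda>X. (X, roof_class C X X (X, id_map C X, id_map C X), X)),
     cmp = (\<lambda>(Y, R', W) (X, R, Y'). (X, roof_comp C X Y W R' R, W))\<rparr>"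

definition loc :: "('o, 'm) preadd \<Rightarrow> (('o, 'm) cpx, ('o, 'm) cmap, ('o, 'm) cpx, ('o, 'm) darr) ftor" where
  "loc C = \<lparr>fo = id, fm = (\<lambda>(X, f, Y). (X, roof_class C X Y (X, id_map C X, f), Y))\<rparr>"

definition zero_darr :: "('o, 'm) preadd \<Rightarrow> ('o, 'm) cpx \<Rightarrow> ('o, 'm) cpx \<Rightarrow> ('o, 'm) darr" where
  "zero_darr C X Y = fm (loc C) (X, (\<lambda>i. zerom C (cob X i) (cob Y i)), Y)"

definition shift :: "('o, 'm) preadd \<Rightarrow> int \<Rightarrow> (('o, 'm) cpx, ('o, 'm) darr, ('o, 'm) cpx, ('o, 'm) darr) ftor" where
  "shift C k = \<lparr>fo = shift_cpx C k,
     fm = (\<lambda>(X, R, Y). (shift_cpx C k X,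
        (\<lambda>(W, s, f). (shift_cpx C k W, shift_map k s, shift_map k f)) ` R, shift_cpx C k Y))\<rparr>"

definition Ext :: "('o, 'm) preadd \<Rightarrow> int \<Rightarrow> 'o \<Rightarrow> 'o \<Rightarrow> ('o, 'm) darr set" where
  "Ext C i E F = Hom (derived C) (stalk C E) (shift_cpx C i (stalk C F))"

definition Ext_zero :: "('o, 'm) preadd \<Rightarrow> int \<Rightarrow> 'o \<Rightarrow> 'o \<Rightarrow> bool" where
  "Ext_zero C i E F \<longleftrightarrow> Ext C i E F = {zero_darr C (stalk C E) (shift_cpx C i (stalk C F))}"

definition homological_dimension :: "('o, 'm) preadd \<Rightarrow> nat \<Rightarrow> bool" where
  "homological_dimension C n \<longleftrightarrow>
     (\<forall>E \<in> objs C. \<forall>F \<in> objs C. \<forall>i. i \<notin> {0..int n} \<longrightarrow> Ext_zero C i E F)"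


section \<open>Triangulated functors and right derived functors\<close>

text \<open>
  \<open>K\<close> is a mapping cone of \<open>u : X \<rightarrow> Y\<close> with inclusion \<open>\<iota> : Y \<rightarrow> K\<close> and projection \<open>\<pi> : K \<rightarrow> X[1]\<close>:
  \<open>K\<^sup>i\<close> is a biproduct of \<open>X\<^sup>i\<^sup>+\<^sup>1\<close> and \<open>Y\<^sup>i\<close>, with differential \<open>(x, y) \<mapsto> (- d x, u x + d y)\<close>.
\<close>

definition is_cone ::
  "('o, 'm) preadd \<Rightarrow> ('o, 'm) cpx \<Rightarrow> ('o, 'm) cpx \<Rightarrow> (int \<Rightarrow> 'm) \<Rightarrow>
   ('o, 'm) cpx \<Rightarrow> (int \<Rightarrow> 'm) \<Rightarrow> (int \<Rightarrow> 'm) \<Rightarrow> bool" where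
  "is_cone C X Y u K \<iota> \<pi> \<longleftrightarrow> K \<in> bcpx C \<and>
     (\<exists>j p. \<forall>i. is_biproduct C (cob X (i + 1)) (cob Y i) (cob K i) (j i) (\<iota> i) (\<pi> i) (p i) \<and>
        cd K i = addm C (j (i + 1) \<cdot>\<^bsub>C\<^esub> negm C (cd X (i + 1)) \<cdot>\<^bsub>C\<^esub> \<pi> i)
          (addm C (\<iota> (i + 1) \<cdot>\<^bsub>C\<^esub> u (i + 1) \<cdot>\<^bsub>C\<^esub> \<pi> i) (\<iota> (i + 1) \<cdot>\<^bsub>C\<^esub> cd Y i \<cdot>\<^bsub>C\<^esub> p i)))"

definition distinguished ::
  "('o, 'm) preadd \<Rightarrow> ('o, 'm) darr \<Rightarrow> ('o, 'm) darr \<Rightarrow> ('o, 'm) darr \<Rightarrow> bool" where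
  "distinguished C f g h \<longleftrightarrow> (let D = derived C; Q = fm (loc C) in
     f \<in> arrs D \<and> g \<in> Hom D (tgt D f) (src D h) \<and>
     h \<in> Hom D (tgt D g) (shift_cpx C 1 (src D f)) \<and>
     (\<exists>X \<in> bcpx C. \<exists>Y \<in> bcpx C. \<exists>u \<in> chain_maps C X Y. \<exists>K \<iota> \<pi>. is_cone C X Y u K \<iota> \<pi> \<and>
       (\<exists>a b c. is_iso D a \<and> a \<in> Hom D (src D f) X \<and> is_iso D b \<and> b \<in> Hom D (tgt D f) Y \<and>
          is_iso D c \<and> c \<in> Hom D (tgt D g) K \<and>
          b \<cdot>\<^bsub>D\<^esub> f = Q (X, u, Y) \<cdot>\<^bsub>D\<^esub> a \<and> c \<cdot>\<^bsub>D\<^esub> g = Q (Y, \<iota>, K) \<cdot>\<^bsub>D\<^esub> b \<and>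
          fm (shift C 1) a \<cdot>\<^bsub>D\<^esub> h = Q (K, \<pi>, shift_cpx C 1 X) \<cdot>\<^bsub>D\<^esub> c)))"

type_synonym ('o, 'm, 'p, 'q) dftor = "(('o, 'm) cpx, ('o, 'm) darr, ('p, 'q) cpx, ('p, 'q) darr) ftor"

text \<open>
  A triangulated functor is a functor \<open>G\<close> with a natural isomorphism \<open>\<theta> : G(-[1]) \<rightarrow> G(-)[1]\<close> that
  preserves distinguished triangles; additivity is a consequence.
\<close>

definition triangulated_functor ::
  "('o, 'm) preadd \<Rightarrow> ('p, 'q) preadd \<Rightarrow> ('o, 'm, 'p, 'q) dftor \<Rightarrow>
   (('o, 'm) cpx \<Rightarrow> ('p, 'q) darr) \<Rightarrow> bool" where
  "triangulated_functor Z A G \<theta> \<longleftrightarrow> is_functor (derived Z) (derived A) G \<and>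
     nat_iso (derived Z) (derived A) (comp_ftor G (shift Z 1)) (comp_ftor (shift A 1) G) \<theta> \<and>
     (\<forall>f g h. distinguished Z f g h \<longrightarrow>
        distinguished A (fm G f) (fm G g) (\<theta> (src (derived Z) f) \<cdot>\<^bsub>derived A\<^esub> fm G h))"

definition triangulated_trans ::
  "('o, 'm) preadd \<Rightarrow> ('p, 'q) preadd \<Rightarrow>
   ('o, 'm, 'p, 'q) dftor \<Rightarrow> (('o, 'm) cpx \<Rightarrow> ('p, 'q) darr) \<Rightarrow>
   ('o, 'm, 'p, 'q) dftor \<Rightarrow> (('o, 'm) cpx \<Rightarrow> ('p, 'q) darr) \<Rightarrow>
   (('o, 'm) cpx \<Rightarrow> ('p, 'q) darr) \<Rightarrow> bool" where
  "triangulated_trans Z A G \<theta> G' \<theta>' \<eta> \<longleftrightarrow> nat_trans (derived Z) (derived A) G G' \<eta> \<and>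
     (\<forall>X \<in> bcpx Z. \<theta>' X \<cdot>\<^bsub>derived A\<^esub> \<eta> (shift_cpx Z 1 X) =
        fm (shift A 1) (\<eta> X) \<cdot>\<^bsub>derived A\<^esub> \<theta> X)"

definition cpx_ftor :: "('o, 'm, 'p, 'q) ftor \<Rightarrow> (('o, 'm) cpx, ('o, 'm) cmap, ('p, 'q) cpx, ('p, 'q) cmap) ftor" where
  "cpx_ftor F = (let Fc = (\<lambda>X. \<lparr>cob = fo F \<circ> cob X, cd = fm F \<circ> cd X\<rparr>)
     in \<lparr>fo = Fc, fm = (\<lambda>(X, f, Y). (Fc X, fm F \<circ> f, Fc Y))\<rparr>)"

text \<open>
  \<open>\<xi>\<close> is a natural transformation from \<open>Q\<^sub>A \<circ> F\<close> to \<open>G \<circ> Q\<^sub>Z\<close>, compatible with shifts. It is stated on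
  complexes instead of the homotopy category; as both composites factor through the latter, this
  makes no difference. Note that an additive \<open>F\<close> commutes with the shift of complexes strictly.
\<close>

definition under_derived ::
  "('o, 'm) preadd \<Rightarrow> ('p, 'q) preadd \<Rightarrow> ('o, 'm, 'p, 'q) ftor \<Rightarrow> ('o, 'm, 'p, 'q) dftor \<Rightarrow>
   (('o, 'm) cpx \<Rightarrow> ('p, 'q) darr) \<Rightarrow> (('o, 'm) cpx \<Rightarrow> ('p, 'q) darr) \<Rightarrow> bool" where
  "under_derived Z A F G \<theta> \<xi> \<longleftrightarrow> triangulated_functor Z A G \<theta> \<and>
     nat_trans (cpx_cat Z) (derived A) (comp_ftor (loc A) (cpx_ftor F)) (comp_ftor G (loc Z)) \<xi> \<and>
     (\<forall>X \<in> bcpx Z. \<theta> X \<cdot>\<^bsub>derived A\<^esub> \<xi> (shift_cpx Z 1 X) = fm (shift A 1) (\<xi> X))"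

definition right_derived ::
  "('o, 'm) preadd \<Rightarrow> ('p, 'q) preadd \<Rightarrow> ('o, 'm, 'p, 'q) ftor \<Rightarrow> ('o, 'm, 'p, 'q) dftor \<Rightarrow> bool" where
  "right_derived Z A F RF \<longleftrightarrow> (\<exists>\<theta> \<xi>. under_derived Z A F RF \<theta> \<xi> \<and>
     (\<forall>G \<theta>' \<zeta>. under_derived Z A F G \<theta>' \<zeta> \<longrightarrow>
        (\<exists>!\<eta>. \<eta> \<in> extensional (bcpx Z) \<and> triangulated_trans Z A RF \<theta> G \<theta>' \<eta> \<and>
           (\<forall>X \<in> bcpx Z. \<zeta> X = \<eta> X \<cdot>\<^bsub>derived A\<^esub> \<xi> X))))"


section \<open>Finitely generated right modules\<close>

text \<open>
  HOL-Algebra only has modules over commutative rings. We reuse its record with \<open>smult M a x\<close>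
  standing for \<open>x a\<close>; the fields \<open>mult\<close> and \<open>one\<close> of \<open>M\<close> are irrelevant.
\<close>

locale right_module = A: ring A + M: abelian_group M
  for A :: "('a, 'y) ring_scheme" and M :: "('a, 'u) module" +
  assumes smult_closed: "a \<in> carrier A \<Longrightarrow> x \<in> carrier M \<Longrightarrow> smult M a x \<in> carrier M"
    and smult_ladd: "a \<in> carrier A \<Longrightarrow> b \<in> carrier A \<Longrightarrow> x \<in> carrier M \<Longrightarrow>
      smult M (a \<oplus>\<^bsub>A\<^esub> b) x = smult M a x \<oplus>\<^bsub>M\<^esub> smult M b x"
    and smult_radd: "a \<in> carrier A \<Longrightarrow> x \<in> carrier M \<Longrightarrow> y \<in> carrier M \<Longrightarrow>
      smult M a (x \<oplus>\<^bsub>M\<^esub> y) = smult M a x \<oplus>\<^bsub>M\<^esub> smult M a y"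
    and smult_mult: "a \<in> carrier A \<Longrightarrow> b \<in> carrier A \<Longrightarrow> x \<in> carrier M \<Longrightarrow>
      smult M (a \<otimes>\<^bsub>A\<^esub> b) x = smult M b (smult M a x)"
    and smult_one: "x \<in> carrier M \<Longrightarrow> smult M \<one>\<^bsub>A\<^esub> x = x"

definition fin_gen :: "('a, 'y) ring_scheme \<Rightarrow> ('a, 'u) module \<Rightarrow> bool" where
  "fin_gen A M \<longleftrightarrow> (\<exists>S. finite S \<and> S \<subseteq> carrier M \<and>
     (\<forall>x \<in> carrier M. \<exists>c \<in> S \<rightarrow> carrier A. x = (\<Oplus>\<^bsub>M\<^esub>s \<in> S. smult M (c s) s)))"

type_synonym ('a, 'u) mod_arr = "('a, 'u) module \<times> ('u \<Rightarrow> 'u) \<times> ('a, 'u) module"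

definition linear_maps ::
  "('a, 'y) ring_scheme \<Rightarrow> ('a, 'u) module \<Rightarrow> ('a, 'u) module \<Rightarrow> ('u \<Rightarrow> 'u) set" where
  "linear_maps A M N = {f \<in> carrier M \<rightarrow>\<^sub>E carrier N.
     (\<forall>x \<in> carrier M. \<forall>y \<in> carrier M. f (x \<oplus>\<^bsub>M\<^esub> y) = f x \<oplus>\<^bsub>N\<^esub> f y) \<and>
     (\<forall>a \<in> carrier A. \<forall>x \<in> carrier M. f (smult M a x) = smult N a (f x))}"

text \<open>
  The elements of the modules are taken from \<open>'a list set\<close>. This type is large enough: every
  finitely generated module is isomorphic to a quotient of some \<open>A\<^sup>k\<close>, whose elements are cosets,
  that is, sets of lists of length \<open>k\<close>.
\<close>

definition fgmod ::
  "('a, 'y) ring_scheme \<Rightarrow> (('a, 'a list set) module, ('a, 'a list set) mod_arr) preadd" where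
  "fgmod A = \<lparr>objs = {M. right_module A M \<and> fin_gen A M},
     arrs = {(M, f, N). right_module A M \<and> fin_gen A M \<and> right_module A N \<and> fin_gen A N \<and>
               f \<in> linear_maps A M N},
     src = (\<lambda>(M, f, N). M), tgt = (\<lambda>(M, f, N). N),
     idt = (\<lambda>M. (M, \<lambda>x \<in> carrier M. x, M)),
     cmp = (\<lambda>(N, g, P) (M, f, N'). (M, compose (carrier M) g f, P)),
     addm = (\<lambda>(M, f, N) (M', g, N'). (M, \<lambda>x \<in> carrier M. f x \<oplus>\<^bsub>N\<^esub> g x, N)),
     zerom = (\<lambda>M N. (M, \<lambda>x \<in> carrier M. \<zero>\<^bsub>N\<^esub>, N))\<rparr>"


section \<open>Tilting objects\<close>

definition End_ring :: "('o, 'm) preadd \<Rightarrow> 'o \<Rightarrow> 'm ring" where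
  "End_ring Z T = \<lparr>carrier = Hom Z T T, mult = cmp Z, one = idt Z T,
     zero = zerom Z T T, add = addm Z\<rparr>"

text \<open>
  \<open>Hom(T, E)\<close> as a right module over \<open>Hom(T, T)\<close>, acting by precomposition. To match the element
  type of \<open>fgmod\<close>, an arrow \<open>f\<close> is encoded as \<open>{[f]}\<close>.
\<close>

definition enc :: "'m \<Rightarrow> 'm list set" where "enc f = {[f]}"

definition decode :: "'m list set \<Rightarrow> 'm" where "decode x = hd (the_elem x)"

definition Hom_mod :: "('o, 'm) preadd \<Rightarrow> 'o \<Rightarrow> 'o \<Rightarrow> ('m, 'm list set) module" where
  "Hom_mod Z T E = \<lparr>carrier = enc ` Hom Z T E, mult = undefined, one = undefined,
     zero = enc (zerom Z T E), add = (\<lambda>x y. enc (addm Z (decode x) (decode y))),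
     smult = (\<lambda>a x. enc (decode x \<cdot>\<^bsub>Z\<^esub> a))\<rparr>"

definition Hom_ftor ::
  "('o, 'm) preadd \<Rightarrow> 'o \<Rightarrow> ('o, 'm, ('m, 'm list set) module, ('m, 'm list set) mod_arr) ftor" where
  "Hom_ftor Z T = \<lparr>fo = Hom_mod Z T,
     fm = (\<lambda>g. (Hom_mod Z T (src Z g), \<lambda>x \<in> enc ` Hom Z T (src Z g). enc (g \<cdot>\<^bsub>Z\<^esub> decode x),
                Hom_mod Z T (tgt Z g)))\<rparr>"

type_synonym ('o, 'm) tilt_ftor = "('o, 'm, ('m, 'm list set) module, ('m, 'm list set) mod_arr) dftor"

definition is_RHom :: "('o, 'm) preadd \<Rightarrow> 'o \<Rightarrow> ('o, 'm) tilt_ftor \<Rightarrow> bool" where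
  "is_RHom Z T \<Phi> \<longleftrightarrow> right_derived Z (fgmod (End_ring Z T)) (Hom_ftor Z T) \<Phi>"

text \<open>
  The second and third clauses only make explicit what it means to speak of \<open>RHom(T, -)\<close> as a functor
  into the derived category of the abelian category of finitely generated modules. As \<open>RHom(T, -)\<close>
  is unique up to isomorphism, it does not matter which one is used in the last clause.
\<close>

definition tilting_object :: "('o, 'm) preadd \<Rightarrow> 'o \<Rightarrow> bool" where
  "tilting_object Z T \<longleftrightarrow> T \<in> objs Z \<and>
     abelian_category (fgmod (End_ring Z T)) \<and>
     is_functor Z (fgmod (End_ring Z T)) (Hom_ftor Z T) \<and>
     (\<forall>i. i \<noteq> 0 \<longrightarrow> Ext_zero Z i T T) \<and>
     (\<exists>\<Phi>. is_RHom Z T \<Phi> \<and> is_equivalence (derived Z) (derived (fgmod (End_ring Z T))) \<Phi>)"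

definition Phi_coh ::
  "('o, 'm) preadd \<Rightarrow> 'o \<Rightarrow> ('o, 'm) tilt_ftor \<Rightarrow> int \<Rightarrow> 'o \<Rightarrow> ('m, 'm list set) module" where
  "Phi_coh Z T \<Phi> i E = cohomology (fgmod (End_ring Z T)) (fo \<Phi> (stalk Z E)) i"

definition B_cls :: "('o, 'm) preadd \<Rightarrow> 'o \<Rightarrow> ('o, 'm) tilt_ftor \<Rightarrow> int \<Rightarrow> 'o set" where
  "B_cls Z T \<Phi> i = {E \<in> objs Z. zero_object (fgmod (End_ring Z T)) (Phi_coh Z T \<Phi> i E)}"

definition T_cls :: "('o, 'm) preadd \<Rightarrow> 'o \<Rightarrow> ('o, 'm) tilt_ftor \<Rightarrow> nat \<Rightarrow> nat \<Rightarrow> 'o set" where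
  "T_cls Z T \<Phi> n i = (if i = n + 1 then objs Z
     else bracket Z (\<Inter>k \<in> {i..n}. B_cls Z T \<Phi> (int k)))"

definition F_cls :: "('o, 'm) preadd \<Rightarrow> 'o \<Rightarrow> ('o, 'm) tilt_ftor \<Rightarrow> nat \<Rightarrow> nat \<Rightarrow> 'o set" where
  "F_cls Z T \<Phi> n i = (if i = 0 then objs Z else if i = n + 1 then Collect (zero_object Z)
     else right_orth Z (T_cls Z T \<Phi> n i))"

end

theory Submission
  imports Defs
begin

text \<open>
  Only the abelian and noetherian structure matters. For any class \<open>\<S>\<close>, the class \<open>[\<S>]\<close> is closed under
  quotients and extensions, so in a noetherian abelian category every object has a greatest subobject
  in \<open>[\<S>]\<close>, and the quotient by it lies in \<open>[\<S>]\<^sup>\<circ>\<close>: these form a torsion pair. Replacing \<open>T\<^sub>0\<close> by the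
  class of zero objects, \<open>T\<^sub>0 \<subseteq> T\<^sub>1 \<subseteq> \<dots> \<subseteq> T\<^sub>n\<^sub>+\<^sub>1\<close> is a chain of torsion classes from zero to the whole
  category, and \<open>E\<^sub>i\<close> is the torsion part of \<open>E\<close> with respect to \<open>T\<^sub>i\<close>. Uniqueness is by descending
  induction: \<open>E\<^sub>i\<close> is the torsion part of \<open>E\<^sub>i\<^sub>+\<^sub>1\<close> with respect to \<open>T\<^sub>i\<close>.
\<close>

section \<open>Elementary properties of abelian categories\<close>

text \<open>The filtrations in \<open>bracket\<close> are chains of equivalence classes of
  monomorphisms, with conditions on all representatives and all cokernels, and they offer no
  induction. Hence \<open>[S]\<close> is rewritten as \<open>ext_hull\<close>, where one quotient of
  an object of \<open>S\<close> at a time is put on top; both closure properties are then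
  inductions. Closure under quotients rests on images: an epimorphism carries a filtration of its
  source to one of its target, and each new factor is a quotient of an old one.

  The greatest torsion subobject is not built as a sum. If \<open>E/E'\<close> receives a nonzero
  map from a torsion object, the preimage in \<open>E\<close> of its image is a strictly larger
  torsion subobject, and ascending chains stop. Conversely, once all such maps vanish, every torsion
  subobject factors through \<open>E'\<close>.

  The classes increase with \<open>i\<close> because a larger \<open>i\<close> imposes fewer
  vanishing conditions. Replacing \<open>T_0\<close> is forced by the convention
  \<open>F_0 = Z\<close>: a class whose right orthogonal is everything contains only zero
  objects.\<close>

lemma HomD: "f \<in> Hom C X Y \<Longrightarrow> f \<in> arrs C" "f \<in> Hom C X Y \<Longrightarrow> src C f = X"
  "f \<in> Hom C X Y \<Longrightarrow> tgt C f = Y"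
  by (auto simp: Hom_def)

lemma arr_Hom: "f \<in> arrs C \<Longrightarrow> f \<in> Hom C (src C f) (tgt C f)"
  by (simp add: Hom_def)

section \<open>Monomorphisms and epimorphisms\<close>

context category
begin

lemma Hom_objs: assumes "f \<in> Hom C X Y" shows "X \<in> objs C" "Y \<in> objs C"
  using assms src_obj tgt_obj by (auto simp: Hom_def)

lemma monoD:
  assumes "is_mono C m" "m \<in> Hom C A B" "f \<in> Hom C W A" "g \<in> Hom C W A" "m \<cdot> f = m \<cdot> g"
  shows "f = g"
  using assms unfolding is_mono_def Hom_def by blast

lemma epiD:
  assumes "is_epi C e" "e \<in> Hom C A B" "f \<in> Hom C B W" "g \<in> Hom C B W" "f \<cdot> e = g \<cdot> e"
  shows "f = g"
  using assms unfolding is_epi_def Hom_def by blast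

lemma is_monoI:
  assumes "m \<in> Hom C A B"
    and "\<And>W f g. f \<in> Hom C W A \<Longrightarrow> g \<in> Hom C W A \<Longrightarrow> m \<cdot> f = m \<cdot> g \<Longrightarrow> f = g"
  shows "is_mono C m"
  using assms unfolding is_mono_def Hom_def by blast

lemma is_epiI:
  assumes "e \<in> Hom C A B"
    and "\<And>W f g. f \<in> Hom C B W \<Longrightarrow> g \<in> Hom C B W \<Longrightarrow> f \<cdot> e = g \<cdot> e \<Longrightarrow> f = g"
  shows "is_epi C e"
  using assms unfolding is_epi_def Hom_def by blast

lemma epi_cmp:
  assumes e: "is_epi C e" "e \<in> Hom C X Y" and d: "is_epi C d" "d \<in> Hom C Y W"
  shows "is_epi C (d \<cdot> e)"
proof (rule is_epiI[OF cmp_hom[OF e(2) d(2)]])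
  fix V f g assume f: "f \<in> Hom C W V" and g: "g \<in> Hom C W V" and eq: "f \<cdot> (d \<cdot> e) = g \<cdot> (d \<cdot> e)"
  have "(f \<cdot> d) \<cdot> e = (g \<cdot> d) \<cdot> e"
    using eq by (simp add: cmp_assoc[OF e(2) d(2) f] cmp_assoc[OF e(2) d(2) g])
  then have "f \<cdot> d = g \<cdot> d" by (rule epiD[OF e cmp_hom[OF d(2) f] cmp_hom[OF d(2) g]])
  then show "f = g" by (rule epiD[OF d f g])
qed

lemma mono_cmp:
  assumes m: "is_mono C m" "m \<in> Hom C X Y" and n: "is_mono C n" "n \<in> Hom C Y W"
  shows "is_mono C (n \<cdot> m)"
proof (rule is_monoI[OF cmp_hom[OF m(2) n(2)]])
  fix V f g assume f: "f \<in> Hom C V X" and g: "g \<in> Hom C V X" and eq: "(n \<cdot> m) \<cdot> f = (n \<cdot> m) \<cdot> g"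
  have "n \<cdot> (m \<cdot> f) = n \<cdot> (m \<cdot> g)"
    using eq by (simp add: cmp_assoc[OF f m(2) n(2)] cmp_assoc[OF g m(2) n(2)])
  then have "m \<cdot> f = m \<cdot> g" by (rule monoD[OF n cmp_hom[OF f m(2)] cmp_hom[OF g m(2)]])
  then show "f = g" by (rule monoD[OF m f g])
qed

lemma mono_left_factor:
  assumes nm: "is_mono C (n \<cdot> m)" and m: "m \<in> Hom C X Y" and n: "n \<in> Hom C Y W"
  shows "is_mono C m"
proof (rule is_monoI[OF m])
  fix V f g assume f: "f \<in> Hom C V X" and g: "g \<in> Hom C V X" and "m \<cdot> f = m \<cdot> g"
  then have "(n \<cdot> m) \<cdot> f = (n \<cdot> m) \<cdot> g" by (simp add: cmp_assoc[OF f m n] cmp_assoc[OF g m n])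
  then show "f = g" by (rule monoD[OF nm cmp_hom[OF m n] f g])
qed

lemma epi_right_factor:
  assumes de: "is_epi C (d \<cdot> e)" and e: "e \<in> Hom C X Y" and d: "d \<in> Hom C Y W"
  shows "is_epi C d"
proof (rule is_epiI[OF d])
  fix V f g assume f: "f \<in> Hom C W V" and g: "g \<in> Hom C W V" and "f \<cdot> d = g \<cdot> d"
  then have "f \<cdot> (d \<cdot> e) = g \<cdot> (d \<cdot> e)"
    by (simp add: cmp_assoc[OF e d f, symmetric] cmp_assoc[OF e d g, symmetric])
  then show "f = g" by (rule epiD[OF de cmp_hom[OF e d] f g])
qed

lemma idt_mono: "X \<in> objs C \<Longrightarrow> is_mono C (idt C X)"
  by (rule is_monoI[OF idt_hom]) (auto simp: idt_left)

lemma idt_epi: "X \<in> objs C \<Longrightarrow> is_epi C (idt C X)"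
  by (rule is_epiI[OF idt_hom]) (auto simp: idt_right)

lemma split_epi:
  assumes "d \<in> Hom C X Y" "s \<in> Hom C Y X" "d \<cdot> s = idt C Y"
  shows "is_epi C d"
  using epi_right_factor[OF _ assms(2,1)] idt_epi Hom_objs[OF assms(1)] assms(3) by simp

section \<open>Subobjects as classes of mutually factoring monomorphisms\<close>

lemma mono_leI: "u \<in> Hom C A A' \<Longrightarrow> m \<in> Hom C A E \<Longrightarrow> m' \<in> Hom C A' E \<Longrightarrow> m = m' \<cdot> u \<Longrightarrow> mono_le C m m'"
  unfolding mono_le_def by (metis HomD(2))

text \<open>Monicity of \<open>n\<close> cancels it from \<open>n \<cdot> u \<cdot> v = n\<close>. A
  one-sided inverse is enough, since membership in a class is later transported along epimorphisms
  only.\<close>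

lemma mono_le_antisym_epi:
  assumes u: "u \<in> Hom C A B" "m = n \<cdot> u" and v: "v \<in> Hom C B A" "n = m \<cdot> v"
    and n: "n \<in> Hom C B E" "is_mono C n"
  shows "is_epi C u"
proof -
  have "n \<cdot> u \<cdot> v = (n \<cdot> u) \<cdot> v" by (rule cmp_assoc[OF v(1) u(1) n(1), symmetric])
  also have "\<dots> = n" unfolding u(2)[symmetric] v(2)[symmetric] ..
  also have "\<dots> = n \<cdot> idt C B" by (rule idt_right[OF n(1), symmetric])
  finally have "u \<cdot> v = idt C B"
    by (rule monoD[OF n(2,1) cmp_hom[OF v(1) u(1)] idt_hom[OF Hom_objs(1)[OF n(1)]]])
  then show ?thesis by (rule split_epi[OF u(1) v(1)])
qed

lemma mono_le_refl:
  assumes "m \<in> arrs C"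
  shows "mono_le C m m"
  using mono_leI[OF idt_hom[OF src_obj[OF assms]] arr_Hom[OF assms] arr_Hom[OF assms]]
    idt_right[OF arr_Hom[OF assms]] by simp

lemma mono_leE:
  assumes "mono_le C m m'" "m' \<in> Hom C A' E"
  obtains u where "u \<in> Hom C (src C m) A'" "m = m' \<cdot> u" "m \<in> Hom C (src C m) E"
proof -
  obtain u where u: "u \<in> Hom C (src C m) A'" "m = m' \<cdot> u"
    using assms unfolding mono_le_def by (auto simp: HomD)
  then show ?thesis using that[OF u] cmp_hom[OF u(1) assms(2)] by simp
qed

lemma mono_le_trans:
  assumes "mono_le C m m'" "mono_le C m' m''" "m'' \<in> arrs C"
  shows "mono_le C m m''"
proof -
  note m'' = arr_Hom[OF assms(3)]
  obtain v where v: "v \<in> Hom C (src C m') (src C m'')" "m' = m'' \<cdot> v" "m' \<in> Hom C (src C m') (tgt C m'')"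
    by (rule mono_leE[OF assms(2) m''])
  obtain u where u: "u \<in> Hom C (src C m) (src C m')" "m = m' \<cdot> u" "m \<in> Hom C (src C m) (tgt C m'')"
    by (rule mono_leE[OF assms(1) v(3)])
  have "m = (m'' \<cdot> v) \<cdot> u" using u(2) v(2) by simp
  also have "\<dots> = m'' \<cdot> (v \<cdot> u)" by (rule cmp_assoc[OF u(1) v(1) m''])
  finally show ?thesis by (rule mono_leI[OF cmp_hom[OF u(1) v(1)] u(3) m''])
qed

lemma monos_into_iff: "m \<in> monos_into C E \<longleftrightarrow> is_mono C m \<and> m \<in> Hom C (src C m) E"
  unfolding monos_into_def is_mono_def Hom_def by auto

lemma subobj_of_iff:
  assumes "m \<in> monos_into C E"
  shows "m' \<in> subobj_of C m \<longleftrightarrow> m' \<in> monos_into C E \<and> mono_le C m m' \<and> mono_le C m' m"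
  using assms unfolding subobj_of_def monos_into_def by auto

lemma mono_into_arr: "m \<in> monos_into C E \<Longrightarrow> m \<in> arrs C"
  by (simp add: monos_into_def is_mono_def)

lemma subobj_of_self: "m \<in> monos_into C E \<Longrightarrow> m \<in> subobj_of C m"
  by (simp add: subobj_of_iff mono_le_refl mono_into_arr)

lemma subobj_of_mono:
  assumes m: "m \<in> monos_into C E" and n: "n \<in> monos_into C E" and le: "mono_le C m n" "mono_le C n m"
  shows "subobj_of C m \<subseteq> subobj_of C n"
proof
  fix x assume "x \<in> subobj_of C m"
  then have x: "x \<in> monos_into C E" "mono_le C m x" "mono_le C x m" using subobj_of_iff[OF m] by auto
  have "mono_le C n x" using mono_le_trans[OF le(2) x(2) mono_into_arr[OF x(1)]] .
  moreover have "mono_le C x n" using mono_le_trans[OF x(3) le(1) mono_into_arr[OF n]] .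
  ultimately show "x \<in> subobj_of C n" using subobj_of_iff[OF n] x by auto
qed

lemma subobj_of_eqI:
  assumes "m \<in> monos_into C E" "n \<in> monos_into C E" "mono_le C m n" "mono_le C n m"
  shows "subobj_of C m = subobj_of C n"
  using subobj_of_mono[OF assms] subobj_of_mono[OF assms(2,1,4,3)] by auto

lemma subobj_of_in: "m \<in> monos_into C E \<Longrightarrow> subobj_of C m \<in> subobjs C E"
  by (simp add: subobjs_def)

lemma subobjs_rep:
  assumes "S \<in> subobjs C E" "m \<in> S"
  shows "m \<in> monos_into C E" "S = subobj_of C m"
proof -
  obtain n where n: "n \<in> monos_into C E" "S = subobj_of C n" using assms unfolding subobjs_def by auto
  then have m: "m \<in> monos_into C E" "mono_le C n m" "mono_le C m n"
    using assms subobj_of_iff[OF n(1)] by auto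
  then show "m \<in> monos_into C E" "S = subobj_of C m" using subobj_of_eqI[OF n(1) m] n by auto
qed

lemma subobjs_equiv:
  assumes "S \<in> subobjs C E" "m \<in> S" "n \<in> S"
  shows "mono_le C m n"
  using subobjs_rep[OF assms(1,2)] assms(3) subobj_of_iff by auto

lemma subobjs_obtain:
  assumes "S \<in> subobjs C E"
  obtains m where "m \<in> monos_into C E" "m \<in> S" "S = subobj_of C m"
  using assms subobj_of_self unfolding subobjs_def by auto

text \<open>Representatives of one subobject factor through one another, so a comparison of one pair
  transfers to every pair. Chains of subobjects can thus be handled through chosen
  monomorphisms.\<close>

lemma sub_le_iff:
  assumes S: "S \<in> subobjs C E" "S' \<in> subobjs C E" and m: "m \<in> S" "m' \<in> S'"
  shows "sub_le C S S' \<longleftrightarrow> mono_le C m m'"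
proof
  assume "sub_le C S S'"
  then obtain n n' where n: "n \<in> S" "n' \<in> S'" "mono_le C n n'" unfolding sub_le_def by auto
  have arr: "n' \<in> arrs C" "m' \<in> arrs C" using subobjs_rep(1)[OF S(2)] n(2) m(2) mono_into_arr by auto
  have "mono_le C m n'" using mono_le_trans[OF subobjs_equiv[OF S(1) m(1) n(1)] n(3) arr(1)] .
  then show "mono_le C m m'" using mono_le_trans[OF _ subobjs_equiv[OF S(2) n(2) m(2)] arr(2)] by auto
next
  assume "mono_le C m m'"
  then show "sub_le C S S'" using m by (auto simp: sub_le_def)
qed

lemma idt_into: "E \<in> objs C \<Longrightarrow> idt C E \<in> monos_into C E"
  using idt_hom[of E] by (simp add: monos_into_iff idt_mono HomD)

lemma sub_top_in: "E \<in> objs C \<Longrightarrow> sub_top C E \<in> subobjs C E" "E \<in> objs C \<Longrightarrow> idt C E \<in> sub_top C E"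
  unfolding sub_top_def by (auto intro: subobj_of_in idt_into subobj_of_self)

lemma mono_le_idt:
  assumes "m \<in> monos_into C E"
  shows "mono_le C m (idt C E)"
proof -
  have m: "m \<in> Hom C (src C m) E" using assms monos_into_iff by auto
  show ?thesis by (rule mono_leI[OF m m idt_hom[OF Hom_objs(2)[OF m]] idt_left[OF m, symmetric]])
qed

lemma monos_into_cmp:
  assumes "m \<in> monos_into C A" "f \<in> monos_into C E" "src C f = A"
  shows "f \<cdot> m \<in> monos_into C E" "src C (f \<cdot> m) = src C m"
proof -
  have h: "m \<in> Hom C (src C m) A" "f \<in> Hom C A E" using assms by (auto simp: monos_into_iff)
  have "f \<cdot> m \<in> Hom C (src C m) E" using cmp_hom[OF h] .
  then show "f \<cdot> m \<in> monos_into C E" "src C (f \<cdot> m) = src C m"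
    using mono_cmp[OF _ h(1) _ h(2)] assms by (auto simp: monos_into_iff HomD)
qed

lemma quotients_iff: "X \<in> quotients C \<S> \<longleftrightarrow> (\<exists>A \<in> \<S>. \<exists>e \<in> Hom C A X. is_epi C e)"
  unfolding quotients_def is_epi_def Hom_def by blast

lemma quotients_epi:
  assumes "X \<in> quotients C \<S>" and e: "e \<in> Hom C X Y" "is_epi C e"
  shows "Y \<in> quotients C \<S>"
proof -
  obtain A d where d: "A \<in> \<S>" "d \<in> Hom C A X" "is_epi C d" using assms quotients_iff by auto
  show ?thesis unfolding quotients_iff using d(1) cmp_hom[OF d(2) e(1)] epi_cmp[OF d(3,2) e(2,1)] by blast
qed

lemma quotients_objs: "quotients C \<S> \<subseteq> objs C"
  using Hom_objs by (auto simp: quotients_iff)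

end

section \<open>Zero morphisms, kernels and cokernels\<close>

context preadditive_category
begin

lemma hom_grp_simps [simp]: "carrier (hom_grp C X Y) = Hom C X Y" "mult (hom_grp C X Y) = addm C"
  "one (hom_grp C X Y) = zerom C X Y"
  by (auto simp: hom_grp_def)

lemma zerom_hom: "X \<in> objs C \<Longrightarrow> Y \<in> objs C \<Longrightarrow> zerom C X Y \<in> Hom C X Y"
  using monoid.one_closed[OF group.is_monoid[OF comm_group.axioms(2)[OF hom_comm_group]]] by simp

text \<open>Additivity of composition makes the composite equal to its own double, which in a group
  forces it to be neutral.\<close>

lemma zerom_cmp:
  assumes f: "f \<in> Hom C X Y" and W: "W \<in> objs C"
  shows "zerom C Y W \<cdot> f = zerom C X W"
proof -
  note o = Hom_objs[OF f]
  interpret G: comm_group "hom_grp C Y W" by (rule hom_comm_group[OF o(2) W])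
  interpret H: comm_group "hom_grp C X W" by (rule hom_comm_group[OF o(1) W])
  let ?z = "zerom C Y W"
  have z: "?z \<in> Hom C Y W" using zerom_hom o W by auto
  have "addm C (?z \<cdot> f) (?z \<cdot> f) = addm C ?z ?z \<cdot> f" using add_cmp[OF f z z] by simp
  also have "addm C ?z ?z = ?z" using G.l_one[of ?z] z by simp
  finally show ?thesis using H.l_cancel_one[of "?z \<cdot> f" "?z \<cdot> f"] cmp_hom[OF f z] by simp
qed

lemma cmp_zerom:
  assumes f: "f \<in> Hom C X Y" and W: "W \<in> objs C"
  shows "f \<cdot> zerom C W X = zerom C W Y"
proof -
  note o = Hom_objs[OF f]
  interpret G: comm_group "hom_grp C W X" by (rule hom_comm_group[OF W o(1)])
  interpret H: comm_group "hom_grp C W Y" by (rule hom_comm_group[OF W o(2)])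
  let ?z = "zerom C W X"
  have z: "?z \<in> Hom C W X" using zerom_hom o W by auto
  have "addm C (f \<cdot> ?z) (f \<cdot> ?z) = f \<cdot> addm C ?z ?z" using cmp_add[OF z z f] by simp
  also have "addm C ?z ?z = ?z" using G.l_one[of ?z] z by simp
  finally show ?thesis using H.l_cancel_one[of "f \<cdot> ?z" "f \<cdot> ?z"] cmp_hom[OF z f] by simp
qed

text \<open>Subtraction reduces cancellation to the zero case: with \<open>h\<close> the inverse of
  \<open>g\<close>, the sum \<open>addm C f h\<close> is the difference of \<open>f\<close> and
  \<open>g\<close>, and \<open>m\<close> kills it.\<close>

lemma mono_trivial_kernelI:
  assumes m: "m \<in> Hom C A B"
    and triv: "\<And>W x. x \<in> Hom C W A \<Longrightarrow> m \<cdot> x = zerom C W B \<Longrightarrow> x = zerom C W A"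
  shows "is_mono C m"
proof (rule is_monoI[OF m])
  fix W f g assume f: "f \<in> Hom C W A" and g: "g \<in> Hom C W A" and eq: "m \<cdot> f = m \<cdot> g"
  note o = Hom_objs[OF f]
  interpret G: comm_group "hom_grp C W A" by (rule hom_comm_group[OF o])
  define h where "h = inv\<^bsub>hom_grp C W A\<^esub> g"
  have h: "h \<in> Hom C W A" "addm C g h = zerom C W A"
    using G.inv_closed[of g] G.r_inv[of g] g by (auto simp: h_def)
  have fh: "addm C f h \<in> Hom C W A" using G.m_closed[of f h] f h by simp
  have "m \<cdot> addm C f h = m \<cdot> addm C g h" using cmp_add[OF f h(1) m] cmp_add[OF g h(1) m] eq by simp
  also have "\<dots> = zerom C W B" using cmp_zerom[OF m o(1)] h by simp
  finally have "addm C f h = addm C g h" using triv fh h by simp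
  then show "f = g" using G.right_cancel[of h f g] f g h by simp
qed

lemma is_kernelI:
  assumes "f \<in> Hom C X Y" "k \<in> Hom C K X" "f \<cdot> k = zerom C K Y" "is_mono C k"
    and "\<And>W g. g \<in> Hom C W X \<Longrightarrow> f \<cdot> g = zerom C W Y \<Longrightarrow> \<exists>u \<in> Hom C W K. k \<cdot> u = g"
  shows "is_kernel C f k"
  unfolding is_kernel_def
proof (intro conjI ballI impI)
  fix g assume "g \<in> arrs C" "tgt C g = src C f \<and> f \<cdot> g = zerom C (src C g) (tgt C f)"
  then have g: "g \<in> Hom C (src C g) X" "f \<cdot> g = zerom C (src C g) Y"
    using HomD[OF assms(1)] arr_Hom by metis+
  show "\<exists>!u. u \<in> Hom C (src C g) (src C k) \<and> k \<cdot> u = g"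
    using assms(5)[OF g] monoD[OF assms(4,2)] HomD[OF assms(2)] by blast
qed (use HomD[OF assms(1)] HomD[OF assms(2)] assms(3) in auto)

lemma is_cokernelI:
  assumes "f \<in> Hom C X Y" "q \<in> Hom C Y Q" "q \<cdot> f = zerom C X Q" "is_epi C q"
    and "\<And>W g. g \<in> Hom C Y W \<Longrightarrow> g \<cdot> f = zerom C X W \<Longrightarrow> \<exists>u \<in> Hom C Q W. u \<cdot> q = g"
  shows "is_cokernel C f q"
  unfolding is_cokernel_def
proof (intro conjI ballI impI)
  fix g assume "g \<in> arrs C" "src C g = tgt C f \<and> g \<cdot> f = zerom C (src C f) (tgt C g)"
  then have g: "g \<in> Hom C Y (tgt C g)" "g \<cdot> f = zerom C X (tgt C g)"
    using HomD[OF assms(1)] arr_Hom by metis+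
  show "\<exists>!u. u \<in> Hom C (tgt C q) (tgt C g) \<and> u \<cdot> q = g"
    using assms(5)[OF g] epiD[OF assms(4,2)] HomD[OF assms(2)] by blast
qed (use HomD[OF assms(1)] HomD[OF assms(2)] assms(3) in auto)

lemma kernel_hom:
  assumes "is_kernel C f k" "f \<in> Hom C X Y"
  shows "k \<in> Hom C (src C k) X" "f \<cdot> k = zerom C (src C k) Y"
  using assms by (auto simp: is_kernel_def Hom_def)

lemma cokernel_hom:
  assumes "is_cokernel C f q" "f \<in> Hom C X Y"
  shows "q \<in> Hom C Y (tgt C q)" "q \<cdot> f = zerom C X (tgt C q)"
  using assms by (auto simp: is_cokernel_def Hom_def)

lemma kernel_factor:
  assumes "is_kernel C f k" "f \<in> Hom C X Y" "g \<in> Hom C W X" "f \<cdot> g = zerom C W Y"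
  obtains u where "u \<in> Hom C W (src C k)" "k \<cdot> u = g"
proof -
  have univ: "\<forall>g \<in> arrs C. tgt C g = src C f \<and> f \<cdot> g = zerom C (src C g) (tgt C f) \<longrightarrow>
      (\<exists>!u. u \<in> Hom C (src C g) (src C k) \<and> k \<cdot> u = g)"
    using assms(1) unfolding is_kernel_def by blast
  have "\<exists>!u. u \<in> Hom C W (src C k) \<and> k \<cdot> u = g"
    using bspec[OF univ HomD(1)[OF assms(3)]]
    unfolding HomD(2,3)[OF assms(2)] HomD(2,3)[OF assms(3)] using assms(4) by simp
  then show ?thesis by (elim ex1E conjE) (rule that)
qed

lemma cokernel_factor:
  assumes "is_cokernel C f q" "f \<in> Hom C X Y" "g \<in> Hom C Y W" "g \<cdot> f = zerom C X W"
  obtains u where "u \<in> Hom C (tgt C q) W" "u \<cdot> q = g"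
proof -
  have univ: "\<forall>g \<in> arrs C. src C g = tgt C f \<and> g \<cdot> f = zerom C (src C f) (tgt C g) \<longrightarrow>
      (\<exists>!u. u \<in> Hom C (tgt C q) (tgt C g) \<and> u \<cdot> q = g)"
    using assms(1) unfolding is_cokernel_def by blast
  have "\<exists>!u. u \<in> Hom C (tgt C q) W \<and> u \<cdot> q = g"
    using bspec[OF univ HomD(1)[OF assms(3)]]
    unfolding HomD(2,3)[OF assms(2)] HomD(2,3)[OF assms(3)] using assms(4) by simp
  then show ?thesis by (elim ex1E conjE) (rule that)
qed

lemma kernel_mono:
  assumes k: "is_kernel C f k"
  shows "is_mono C k"
proof -
  have f: "f \<in> Hom C (src C f) (tgt C f)" using k by (simp add: is_kernel_def Hom_def)
  note kh = kernel_hom[OF k f]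
  show ?thesis
  proof (rule is_monoI[OF kh(1)])
    fix W u v assume u: "u \<in> Hom C W (src C k)" and v: "v \<in> Hom C W (src C k)" and eq: "k \<cdot> u = k \<cdot> v"
    let ?g = "k \<cdot> u"
    have g: "?g \<in> Hom C W (src C f)" using cmp_hom[OF u kh(1)] .
    have "f \<cdot> ?g = zerom C W (tgt C f)"
      using cmp_assoc[OF u kh(1) f] kh(2) zerom_cmp[OF u] Hom_objs[OF f] by simp
    moreover have "\<forall>g \<in> arrs C. tgt C g = src C f \<and> f \<cdot> g = zerom C (src C g) (tgt C f) \<longrightarrow>
        (\<exists>!u. u \<in> Hom C (src C g) (src C k) \<and> k \<cdot> u = g)"
      using k unfolding is_kernel_def by blast
    from bspec[OF this HomD(1)[OF g]]
    have "f \<cdot> ?g = zerom C W (tgt C f) \<longrightarrow> (\<exists>!w. w \<in> Hom C W (src C k) \<and> k \<cdot> w = ?g)"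
      unfolding HomD(2,3)[OF g] by simp
    ultimately show "u = v" using u v eq by metis
  qed
qed

lemma cokernel_epi:
  assumes q: "is_cokernel C f q"
  shows "is_epi C q"
proof -
  have f: "f \<in> Hom C (src C f) (tgt C f)" using q by (simp add: is_cokernel_def Hom_def)
  note qh = cokernel_hom[OF q f]
  show ?thesis
  proof (rule is_epiI[OF qh(1)])
    fix W u v assume u: "u \<in> Hom C (tgt C q) W" and v: "v \<in> Hom C (tgt C q) W" and eq: "u \<cdot> q = v \<cdot> q"
    let ?g = "u \<cdot> q"
    have g: "?g \<in> Hom C (tgt C f) W" using cmp_hom[OF qh(1) u] .
    have "?g \<cdot> f = zerom C (src C f) W"
      using cmp_assoc[OF f qh(1) u] qh(2) cmp_zerom[OF u] Hom_objs[OF f] by simp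
    moreover have "\<forall>g \<in> arrs C. src C g = tgt C f \<and> g \<cdot> f = zerom C (src C f) (tgt C g) \<longrightarrow>
        (\<exists>!u. u \<in> Hom C (tgt C q) (tgt C g) \<and> u \<cdot> q = g)"
      using q unfolding is_cokernel_def by blast
    from bspec[OF this HomD(1)[OF g]]
    have "?g \<cdot> f = zerom C (src C f) W \<longrightarrow> (\<exists>!w. w \<in> Hom C (tgt C q) W \<and> w \<cdot> q = ?g)"
      unfolding HomD(2,3)[OF g] by simp
    ultimately show "u = v" using u v eq by metis
  qed
qed

lemma zero_object_hom:
  assumes "zero_object C X"
  shows "f \<in> Hom C X Y \<Longrightarrow> f = zerom C X Y" "f \<in> Hom C Y X \<Longrightarrow> f = zerom C Y X"
proof -
  have X: "X \<in> objs C" using assms by (simp add: zero_object_def)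
  show "f = zerom C X Y" if f: "f \<in> Hom C X Y"
  proof -
    have Y: "Y \<in> objs C" using Hom_objs[OF f] by simp
    then have "\<exists>!f. f \<in> Hom C X Y" using assms unfolding zero_object_def by blast
    then show ?thesis using f zerom_hom[OF X Y] by blast
  qed
  show "f = zerom C Y X" if f: "f \<in> Hom C Y X"
  proof -
    have Y: "Y \<in> objs C" using Hom_objs[OF f] by simp
    then have "\<exists>!f. f \<in> Hom C Y X" using assms unfolding zero_object_def by blast
    then show ?thesis using f zerom_hom[OF Y X] by blast
  qed
qed

text \<open>If the identity vanishes, composing with it annihilates every arrow in or out. In this
  form an object that lies both in a class and in its right orthogonal is recognized as
  zero.\<close>

lemma zero_object_iff:
  "zero_object C X \<longleftrightarrow> X \<in> objs C \<and> idt C X = zerom C X X"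
proof
  assume X: "zero_object C X"
  then have "X \<in> objs C" by (simp add: zero_object_def)
  then show "X \<in> objs C \<and> idt C X = zerom C X X" using zero_object_hom(1)[OF X idt_hom] by simp
next
  assume X: "X \<in> objs C \<and> idt C X = zerom C X X"
  have 1: "f = zerom C X Y" if "f \<in> Hom C X Y" for f Y
    using idt_right[OF that] X cmp_zerom[OF that, of X] by auto
  have 2: "f = zerom C Y X" if "f \<in> Hom C Y X" for f Y
    using idt_left[OF that] X zerom_cmp[OF that, of X] by auto
  have "(\<exists>!f. f \<in> Hom C X Y) \<and> (\<exists>!f. f \<in> Hom C Y X)" if "Y \<in> objs C" for Y
    using zerom_hom[of X Y] zerom_hom[of Y X] X that 1[of _ Y] 2[of _ Y] by blast
  then show "zero_object C X" using X by (auto simp: zero_object_def)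
qed

lemma zero_object_mono:
  assumes Y: "zero_object C Y" and m: "m \<in> Hom C X Y" "is_mono C m"
  shows "zero_object C X"
proof -
  have X: "X \<in> objs C" using Hom_objs[OF m(1)] by simp
  note z = idt_hom[OF X] zerom_hom[OF X X]
  have "m \<cdot> idt C X = m \<cdot> zerom C X X"
    using zero_object_hom(2)[OF Y cmp_hom[OF z(1) m(1)]] zero_object_hom(2)[OF Y cmp_hom[OF z(2) m(1)]] by simp
  then show ?thesis using monoD[OF m(2,1) z] X zero_object_iff by simp
qed

lemma zero_object_epi:
  assumes X: "zero_object C X" and e: "e \<in> Hom C X Y" "is_epi C e"
  shows "zero_object C Y"
proof -
  have Y: "Y \<in> objs C" using Hom_objs[OF e(1)] by simp
  note z = idt_hom[OF Y] zerom_hom[OF Y Y]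
  have "idt C Y \<cdot> e = zerom C Y Y \<cdot> e"
    using zero_object_hom(1)[OF X cmp_hom[OF e(1) z(1)]] zero_object_hom(1)[OF X cmp_hom[OF e(1) z(2)]] by simp
  then show ?thesis using epiD[OF e(2,1) z] Y zero_object_iff by simp
qed

end

section \<open>Images, short exact sequences and preimages\<close>

context abelian_category
begin

text \<open>Normality makes \<open>m\<close> the kernel of some \<open>f\<close>. As
  \<open>f\<close> kills \<open>m\<close>, it factors through \<open>q\<close>; so whatever
  \<open>q\<close> kills is killed by \<open>f\<close> and factors through \<open>m\<close>.\<close>

lemma mono_is_kernel:
  assumes m: "is_mono C m" and q: "is_cokernel C m q"
  shows "is_kernel C q m"
proof -
  obtain f where f: "is_kernel C f m" using mono_normal[OF m] by auto
  have fh: "f \<in> Hom C (src C f) (tgt C f)" using f by (simp add: is_kernel_def Hom_def)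
  note mh = kernel_hom[OF f fh]
  note qh = cokernel_hom[OF q mh(1)]
  obtain w where w: "w \<in> Hom C (tgt C q) (tgt C f)" "w \<cdot> q = f"
    using cokernel_factor[OF q mh(1) fh mh(2)] by metis
  show ?thesis
  proof (rule is_kernelI[OF qh(1) mh(1) qh(2) m])
    fix W g assume g: "g \<in> Hom C W (src C f)" "q \<cdot> g = zerom C W (tgt C q)"
    have "f \<cdot> g = zerom C W (tgt C f)"
      using cmp_assoc[OF g(1) qh(1) w(1)] w g cmp_zerom[OF w(1)] Hom_objs[OF g(1)] by simp
    then show "\<exists>u \<in> Hom C W (src C m). m \<cdot> u = g" using kernel_factor[OF f fh g(1)] by metis
  qed
qed

lemma epi_is_cokernel:
  assumes e: "is_epi C e" and k: "is_kernel C e k"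
  shows "is_cokernel C k e"
proof -
  obtain f where f: "is_cokernel C f e" using epi_normal[OF e] by auto
  have fh: "f \<in> Hom C (src C f) (tgt C f)" using f by (simp add: is_cokernel_def Hom_def)
  note eh = cokernel_hom[OF f fh]
  note kh = kernel_hom[OF k eh(1)]
  obtain w where w: "w \<in> Hom C (src C f) (src C k)" "k \<cdot> w = f"
    using kernel_factor[OF k eh(1) fh eh(2)] by metis
  show ?thesis
  proof (rule is_cokernelI[OF kh(1) eh(1) kh(2) e])
    fix W g assume g: "g \<in> Hom C (tgt C f) W" "g \<cdot> k = zerom C (src C k) W"
    have "g \<cdot> f = zerom C (src C f) W"
      using cmp_assoc[OF w(1) kh(1) g(1)] w g zerom_cmp[OF w(1)] Hom_objs[OF g(1)] by simp
    then show "\<exists>u \<in> Hom C (tgt C e) W. u \<cdot> e = g" using cokernel_factor[OF f fh g(1)] by metis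
  qed
qed

text \<open>If \<open>m\<close> kills \<open>x\<close> and \<open>q\<close> is the cokernel of
  \<open>x\<close>, then \<open>f\<close> factors through the epimorphism
  \<open>q \<cdot> e\<close>. The kernel \<open>h\<close> of the latter is killed by
  \<open>f\<close>, hence factors through \<open>k\<close> and is killed by \<open>e\<close>. So
  \<open>e\<close> factors through \<open>q \<cdot> e\<close>, which gives \<open>q\<close> a left
  inverse \<open>s\<close> and makes \<open>x = s \<cdot> q \<cdot> x\<close> vanish.\<close>

lemma coimage_mono:
  assumes f: "f \<in> Hom C X Y" and k: "is_kernel C f k" and e: "is_cokernel C k e"
    and m: "m \<in> Hom C (tgt C e) Y" and fm: "f = m \<cdot> e"
  shows "is_mono C m"
proof (rule mono_trivial_kernelI[OF m])
  note kh = kernel_hom[OF k f]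
  note eh = cokernel_hom[OF e kh(1)]
  fix W x assume x: "x \<in> Hom C W (tgt C e)" "m \<cdot> x = zerom C W Y"
  obtain q where q: "is_cokernel C x q" using ex_cokernel HomD(1)[OF x(1)] by metis
  note qh = cokernel_hom[OF q x(1)]
  obtain m' where m': "m' \<in> Hom C (tgt C q) Y" "m' \<cdot> q = m" using cokernel_factor[OF q x(1) m x(2)] by metis
  have qe: "q \<cdot> e \<in> Hom C X (tgt C q)" using cmp_hom[OF eh(1) qh(1)] .
  have "is_epi C (q \<cdot> e)" using epi_cmp[OF cokernel_epi[OF e] eh(1) cokernel_epi[OF q] qh(1)] .
  moreover obtain h where h: "is_kernel C (q \<cdot> e) h" using ex_kernel HomD(1)[OF qe] by metis
  ultimately have ch: "is_cokernel C h (q \<cdot> e)" using epi_is_cokernel by metis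
  note hh = kernel_hom[OF h qe]
  have "f = m' \<cdot> (q \<cdot> e)" using fm m' cmp_assoc[OF eh(1) qh(1) m'(1)] by simp
  then have "f \<cdot> h = zerom C (src C h) Y"
    using cmp_assoc[OF hh(1) qe m'(1)] hh cmp_zerom[OF m'(1)] Hom_objs[OF hh(1)] by simp
  then obtain l where l: "l \<in> Hom C (src C h) (src C k)" "k \<cdot> l = h" using kernel_factor[OF k f hh(1)] by metis
  have "e \<cdot> h = zerom C (src C h) (tgt C e)"
    using cmp_assoc[OF l(1) kh(1) eh(1)] l eh(2) zerom_cmp[OF l(1)] Hom_objs[OF eh(1)] by simp
  then obtain s where s: "s \<in> Hom C (tgt C q) (tgt C e)" "s \<cdot> (q \<cdot> e) = e"
    using cokernel_factor[OF ch hh(1) eh(1)] HomD(3)[OF qe] by metis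
  have sq: "s \<cdot> q \<in> Hom C (tgt C e) (tgt C e)" using cmp_hom[OF qh(1) s(1)] .
  have "(s \<cdot> q) \<cdot> e = idt C (tgt C e) \<cdot> e"
    using cmp_assoc[OF eh(1) qh(1) s(1)] s idt_left[OF eh(1)] by simp
  then have "s \<cdot> q = idt C (tgt C e)"
    using epiD[OF cokernel_epi[OF e] eh(1)] sq idt_hom Hom_objs[OF eh(1)] by metis
  then have "x = s \<cdot> (q \<cdot> x)" using cmp_assoc[OF x(1) qh(1) s(1)] idt_left[OF x(1)] by simp
  also have "\<dots> = zerom C W (tgt C e)" using qh(2) cmp_zerom[OF s(1)] Hom_objs[OF x(1)] by simp
  finally show "x = zerom C W (tgt C e)" .
qed

lemma image_factorization:
  assumes f: "f \<in> Hom C X Y"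
  obtains I e m where "e \<in> Hom C X I" "m \<in> Hom C I Y" "f = m \<cdot> e" "is_epi C e" "is_mono C m"
proof -
  obtain k where k: "is_kernel C f k" using ex_kernel HomD(1)[OF f] by metis
  note kh = kernel_hom[OF k f]
  obtain e where e: "is_cokernel C k e" using ex_cokernel HomD(1)[OF kh(1)] by metis
  note eh = cokernel_hom[OF e kh(1)]
  obtain m where m: "m \<in> Hom C (tgt C e) Y" "m \<cdot> e = f"
    using cokernel_factor[OF e kh(1) f kh(2)] by metis
  show ?thesis using that[OF eh(1) m(1)] m(2) cokernel_epi[OF e] coimage_mono[OF f k e m(1)] by metis
qed

lemma short_exactD:
  assumes "short_exact C f g"
  shows "is_kernel C g f" "is_cokernel C f g"
  using assms by (auto simp: short_exact_def)

lemma short_exact_hom: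
  assumes fg: "short_exact C f g"
  shows "f \<in> Hom C (src C f) (tgt C f)" "g \<in> Hom C (tgt C f) (tgt C g)"
    "g \<cdot> f = zerom C (src C f) (tgt C g)" "is_mono C f" "is_epi C g"
proof -
  show f: "f \<in> Hom C (src C f) (tgt C f)"
    using short_exactD(1)[OF fg] by (simp add: is_kernel_def Hom_def)
  show "g \<in> Hom C (tgt C f) (tgt C g)" "g \<cdot> f = zerom C (src C f) (tgt C g)"
    using cokernel_hom[OF short_exactD(2)[OF fg] f] by auto
  show "is_mono C f" "is_epi C g"
    using kernel_mono[OF short_exactD(1)[OF fg]] cokernel_epi[OF short_exactD(2)[OF fg]] by auto
qed

lemma short_exact_of_mono:
  assumes m: "is_mono C m"
  obtains q where "short_exact C m q"
proof -
  obtain q where "is_cokernel C m q" using ex_cokernel m unfolding is_mono_def by blast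
  then show ?thesis using that mono_is_kernel[OF m] by (auto simp: short_exact_def)
qed

lemma short_exact_of_epi:
  assumes e: "is_epi C e"
  obtains k where "short_exact C k e"
proof -
  obtain k where "is_kernel C e k" using ex_kernel e unfolding is_epi_def by blast
  then show ?thesis using that epi_is_cokernel[OF e] by (auto simp: short_exact_def)
qed

text \<open>The preimage in \<open>E\<close> of the subobject \<open>b\<close> of \<open>E/A\<close> is an extension of \<open>b\<close> by \<open>A\<close>.\<close>

lemma preimage_exact:
  assumes aq: "short_exact C a q" and bg: "short_exact C b g" and qb: "tgt C q = tgt C b"
  obtains i c a' where "short_exact C i (g \<cdot> q)" "short_exact C a' c" "a = i \<cdot> a'"
    "src C a' = src C a" "tgt C a' = src C i" "tgt C c = src C b" "tgt C i = tgt C a" "b \<cdot> c = q \<cdot> i"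
proof -
  note ah = short_exact_hom[OF aq] and bh = short_exact_hom[OF bg]
  have g: "g \<in> Hom C (tgt C q) (tgt C g)" using bh(2) qb by simp
  have b: "b \<in> Hom C (src C b) (tgt C q)" using bh(1) qb by simp
  have gq: "g \<cdot> q \<in> Hom C (tgt C a) (tgt C g)" using cmp_hom[OF ah(2) g] .
  \<comment> \<open>As \<open>b\<close> is the kernel of \<open>g\<close>, its preimage under
    \<open>q\<close> is the kernel of \<open>g \<cdot> q\<close>.\<close>
  obtain i where i: "short_exact C i (g \<cdot> q)"
    using short_exact_of_epi[OF epi_cmp[OF ah(5,2) bh(5) g]] by metis
  note ih0 = short_exact_hom[OF i]
  have ti: "tgt C i = tgt C a" using ih0(2) gq HomD(2) by metis
  have tgq: "tgt C (g \<cdot> q) = tgt C g" using HomD(3)[OF gq] .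
  have ih: "i \<in> Hom C (src C i) (tgt C a)" "g \<cdot> q \<cdot> i = zerom C (src C i) (tgt C g)"
    using ih0(1,3) ti tgq cmp_assoc[OF _ ah(2) g, of i "src C i"] by auto
  have "g \<cdot> q \<cdot> a = zerom C (src C a) (tgt C g)"
    using ah(3) cmp_zerom[OF g] Hom_objs[OF ah(1)] by simp
  then have "(g \<cdot> q) \<cdot> a = zerom C (src C a) (tgt C g)" using cmp_assoc[OF ah(1,2) g] by simp
  then obtain a' where a': "a' \<in> Hom C (src C a) (src C i)" "i \<cdot> a' = a"
    using kernel_factor[OF short_exactD(1)[OF i] gq ah(1)] by metis
  have qi: "q \<cdot> i \<in> Hom C (src C i) (tgt C q)" using cmp_hom[OF ih(1) ah(2)] .
  obtain c where c: "c \<in> Hom C (src C i) (src C b)" "b \<cdot> c = q \<cdot> i"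
    using kernel_factor[OF short_exactD(1)[OF bg] g qi ih(2)] by metis
  \<comment> \<open>Let \<open>m\<close> be the image of \<open>c\<close> and \<open>r\<close> the
    cokernel of \<open>b \<cdot> m\<close>. Then \<open>r \<cdot> q\<close> kills \<open>i\<close>,
    so it factors through \<open>g \<cdot> q\<close>, and \<open>r\<close> factors through
    \<open>g\<close>. Hence \<open>r\<close> kills \<open>b\<close>, so \<open>b\<close> factors
    through \<open>b \<cdot> m\<close>, and \<open>m\<close> is a split epimorphism.\<close>
  have epi: "is_epi C c"
  proof -
    obtain I e m where em: "e \<in> Hom C (src C i) I" "m \<in> Hom C I (src C b)" "c = m \<cdot> e"
      "is_epi C e" "is_mono C m" using image_factorization[OF c(1)] by metis
    have bm: "b \<cdot> m \<in> Hom C I (tgt C q)" "is_mono C (b \<cdot> m)"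
      using cmp_hom[OF em(2) b] mono_cmp[OF em(5,2) bh(4) b] by auto
    obtain r where r: "short_exact C (b \<cdot> m) r" using short_exact_of_mono[OF bm(2)] by metis
    have rh: "r \<in> Hom C (tgt C q) (tgt C r)" "r \<cdot> b \<cdot> m = zerom C I (tgt C r)"
      using short_exact_hom[OF r] HomD[OF bm(1)] by auto
    have ro: "tgt C r \<in> objs C" using Hom_objs[OF rh(1)] by simp
    have "(r \<cdot> q) \<cdot> i = r \<cdot> b \<cdot> c" using cmp_assoc[OF ih(1) ah(2) rh(1)] c(2) by simp
    also have "\<dots> = r \<cdot> (b \<cdot> m) \<cdot> e" using em(3) cmp_assoc[OF em(1,2) b] by simp
    also have "\<dots> = (r \<cdot> b \<cdot> m) \<cdot> e" using cmp_assoc[OF em(1) bm(1) rh(1)] by simp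
    also have "\<dots> = zerom C (src C i) (tgt C r)" using rh(2) zerom_cmp[OF em(1) ro] by simp
    finally obtain w where w: "w \<in> Hom C (tgt C g) (tgt C r)" "w \<cdot> (g \<cdot> q) = r \<cdot> q"
      using cokernel_factor[OF short_exactD(2)[OF i] ih(1) cmp_hom[OF ah(2) rh(1)]] unfolding tgq by metis
    then have "(w \<cdot> g) \<cdot> q = r \<cdot> q" using cmp_assoc[OF ah(2) g w(1)] by simp
    then have wg: "w \<cdot> g = r" using epiD[OF ah(5,2)] cmp_hom[OF g w(1)] rh(1) by metis
    have "r \<cdot> b = w \<cdot> g \<cdot> b" using wg cmp_assoc[OF b g w(1)] by simp
    also have "\<dots> = zerom C (src C b) (tgt C r)" using bh(3) cmp_zerom[OF w(1)] Hom_objs[OF b] by simp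
    finally obtain u where u: "u \<in> Hom C (src C b) I" "(b \<cdot> m) \<cdot> u = b"
      using kernel_factor[OF short_exactD(1)[OF r] rh(1) b] unfolding HomD(2)[OF bm(1)] by metis
    have "b \<cdot> (m \<cdot> u) = b \<cdot> idt C (src C b)" using u cmp_assoc[OF u(1) em(2) b] idt_right[OF b] by simp
    then have "m \<cdot> u = idt C (src C b)"
      using monoD[OF bh(4) b] cmp_hom[OF u(1) em(2)] idt_hom Hom_objs[OF b] by metis
    then have "is_epi C m" using split_epi em(2) u(1) by metis
    then show ?thesis using epi_cmp[OF em(4,1) _ em(2)] em(3) by simp
  qed
  have "is_kernel C c a'"
  proof (rule is_kernelI[OF c(1) a'(1)])
    have "b \<cdot> c \<cdot> a' = (q \<cdot> i) \<cdot> a'" using cmp_assoc[OF a'(1) c(1) b] c by simp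
    also have "\<dots> = zerom C (src C a) (tgt C q)" using cmp_assoc[OF a'(1) ih(1) ah(2)] a' ah by simp
    also have "\<dots> = b \<cdot> zerom C (src C a) (src C b)" using cmp_zerom[OF b] Hom_objs[OF ah(1)] by simp
    finally show "c \<cdot> a' = zerom C (src C a) (src C b)"
      using monoD[OF bh(4) b cmp_hom[OF a'(1) c(1)] zerom_hom] Hom_objs[OF ah(1)] Hom_objs[OF b] by metis
    show "is_mono C a'" using mono_left_factor[OF _ a'(1) ih(1)] ah(4) a'(2) by simp
    fix W x assume x: "x \<in> Hom C W (src C i)" "c \<cdot> x = zerom C W (src C b)"
    have ix: "i \<cdot> x \<in> Hom C W (tgt C a)" using cmp_hom[OF x(1) ih(1)] .
    have "q \<cdot> i \<cdot> x = b \<cdot> c \<cdot> x" using cmp_assoc[OF x(1) ih(1) ah(2)] cmp_assoc[OF x(1) c(1) b] c by simp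
    also have "\<dots> = zerom C W (tgt C q)" using x(2) cmp_zerom[OF b] Hom_objs[OF x(1)] by simp
    finally obtain y where y: "y \<in> Hom C W (src C a)" "a \<cdot> y = i \<cdot> x"
      using kernel_factor[OF short_exactD(1)[OF aq] ah(2) ix] by metis
    have "i \<cdot> (a' \<cdot> y) = i \<cdot> x" using y a' cmp_assoc[OF y(1) a'(1) ih(1)] by simp
    then have "a' \<cdot> y = x" using monoD[OF ih0(4) ih(1) cmp_hom[OF y(1) a'(1)] x(1)] by simp
    then show "\<exists>u \<in> Hom C W (src C a). a' \<cdot> u = x" using y(1) by auto
  qed
  then have "short_exact C a' c" using epi_is_cokernel[OF epi] unfolding short_exact_def by auto
  then show ?thesis using that[OF i _ a'(2)[symmetric]] HomD[OF a'(1)] HomD[OF c(1)] ti c(2) by auto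
qed

lemma right_orthD: "E \<in> right_orth C \<V> \<Longrightarrow> V \<in> \<V> \<Longrightarrow> f \<in> Hom C V E \<Longrightarrow> f = zerom C V E"
  by (auto simp: right_orth_def)

lemma right_orthI:
  assumes E: "E \<in> objs C" and V: "\<V> \<subseteq> objs C"
    and zero: "\<And>V f. V \<in> \<V> \<Longrightarrow> f \<in> Hom C V E \<Longrightarrow> f = zerom C V E"
  shows "E \<in> right_orth C \<V>"
  unfolding right_orth_def using E zerom_hom[OF _ E] V zero by blast

text \<open>A map from \<open>V\<close> into the middle term vanishes in the quotient, hence lifts
  to the subobject, where it vanishes too.\<close>

lemma ext_closed_right_orth:
  assumes V: "\<V> \<subseteq> objs C"
  shows "ext_closed C (right_orth C \<V>)"
  unfolding ext_closed_def
proof (intro allI impI)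
  fix f g assume "short_exact C f g \<and> src C f \<in> right_orth C \<V> \<and> tgt C g \<in> right_orth C \<V>"
  then have fg: "short_exact C f g" and o: "src C f \<in> right_orth C \<V>" "tgt C g \<in> right_orth C \<V>" by auto
  note h = short_exact_hom[OF fg]
  show "tgt C f \<in> right_orth C \<V>"
  proof (rule right_orthI[OF Hom_objs(2)[OF h(1)] V])
    fix V x assume V: "V \<in> \<V>" and x: "x \<in> Hom C V (tgt C f)"
    have "g \<cdot> x = zerom C V (tgt C g)" by (rule right_orthD[OF o(2) V cmp_hom[OF x h(2)]])
    then obtain y where y: "y \<in> Hom C V (src C f)" "f \<cdot> y = x"
      by (rule kernel_factor[OF short_exactD(1)[OF fg] h(2) x])
    show "x = zerom C V (tgt C f)"
      using y(2) right_orthD[OF o(1) V y(1)] cmp_zerom[OF h(1)] Hom_objs(1)[OF x] by simp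
  qed
qed

text \<open>If \<open>m\<close> and \<open>n \<cdot> u\<close> are the same subobject of \<open>E\<close>, this embeds \<open>A/A'\<close> into \<open>E/A'\<close>.\<close>

lemma quotient_embedding:
  assumes n: "n \<in> Hom C A E" "is_mono C n" and u: "u \<in> Hom C A' A" "is_mono C (n \<cdot> u)"
    and q: "is_cokernel C u q" and mr: "short_exact C m r" "tgt C m = E"
    and le: "mono_le C m (n \<cdot> u)" "mono_le C (n \<cdot> u) m"
  obtains w where "w \<in> Hom C (tgt C q) (tgt C r)" "is_mono C w"
proof -
  note mh = short_exact_hom[OF mr(1), unfolded mr(2)]
  note qh = cokernel_hom[OF q u(1)]
  have nu: "n \<cdot> u \<in> Hom C A' E" by (rule cmp_hom[OF u(1) n(1)])
  obtain v where v: "v \<in> Hom C A' (src C m)" "n \<cdot> u = m \<cdot> v"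
    by (rule mono_leE[OF le(2) mh(1), unfolded HomD(2)[OF nu]])
  obtain v' where v': "v' \<in> Hom C (src C m) A'" "m = (n \<cdot> u) \<cdot> v'"
    by (rule mono_leE[OF le(1) nu])
  have rn: "r \<cdot> n \<in> Hom C A (tgt C r)" by (rule cmp_hom[OF n(1) mh(2)])
  have "r \<cdot> n \<cdot> u = (r \<cdot> m) \<cdot> v" using v(2) cmp_assoc[OF v(1) mh(1,2)] by simp
  also have "\<dots> = zerom C A' (tgt C r)" using mh(3) zerom_cmp[OF v(1)] Hom_objs[OF mh(2)] by simp
  finally have rnu: "(r \<cdot> n) \<cdot> u = zerom C A' (tgt C r)" using cmp_assoc[OF u(1) n(1) mh(2)] by simp
  obtain w where w: "w \<in> Hom C (tgt C q) (tgt C r)" "w \<cdot> q = r \<cdot> n"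
    by (rule cokernel_factor[OF q u(1) rn rnu])
  \<comment> \<open>With \<open>u\<close> as the kernel of \<open>r \<cdot> n\<close>, the map
    \<open>w\<close> on the cokernel of \<open>u\<close> is the map from the coimage of
    \<open>r \<cdot> n\<close> to its target, which is monic by \<open>coimage_mono\<close>.\<close>
  have "is_kernel C (r \<cdot> n) u"
  proof (rule is_kernelI[OF rn u(1) rnu mono_left_factor[OF u(2,1) n(1)]])
    fix W x assume x: "x \<in> Hom C W A" "(r \<cdot> n) \<cdot> x = zerom C W (tgt C r)"
    have nx: "n \<cdot> x \<in> Hom C W E" by (rule cmp_hom[OF x(1) n(1)])
    have "r \<cdot> n \<cdot> x = zerom C W (tgt C r)" using x cmp_assoc[OF x(1) n(1) mh(2)] by simp
    then obtain y where y: "y \<in> Hom C W (src C m)" "m \<cdot> y = n \<cdot> x"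
      by (rule kernel_factor[OF short_exactD(1)[OF mr(1)] mh(2) nx])
    have vy: "v' \<cdot> y \<in> Hom C W A'" by (rule cmp_hom[OF y(1) v'(1)])
    have "n \<cdot> x = ((n \<cdot> u) \<cdot> v') \<cdot> y" using y(2) v'(2) by simp
    also have "\<dots> = n \<cdot> u \<cdot> v' \<cdot> y"
      by (simp add: cmp_assoc[OF y(1) v'(1) nu] cmp_assoc[OF vy u(1) n(1)])
    finally have "u \<cdot> v' \<cdot> y = x" using monoD[OF n(2,1) x(1) cmp_hom[OF vy u(1)]] by simp
    then show "\<exists>z \<in> Hom C W A'. u \<cdot> z = x" using vy by blast
  qed
  then have "is_mono C w" by (rule coimage_mono[OF rn _ q w(1) w(2)[symmetric]])
  then show ?thesis by (rule that[OF w(1)])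
qed

lemma zero_mono: "zero_object C N \<Longrightarrow> E \<in> objs C \<Longrightarrow> zerom C N E \<in> monos_into C E"
proof -
  assume N: "zero_object C N" and E: "E \<in> objs C"
  have h: "zerom C N E \<in> Hom C N E" by (rule zerom_hom[OF _ E]) (use N in \<open>simp add: zero_object_def\<close>)
  have "is_mono C (zerom C N E)"
    by (rule mono_trivial_kernelI[OF h]) (rule zero_object_hom(2)[OF N])
  then show ?thesis using h by (simp add: monos_into_iff HomD(2)[OF h])
qed

lemma mono_le_of_zero:
  assumes m: "m \<in> monos_into C E" "zero_object C (src C m)" and n: "n \<in> monos_into C E"
  shows "mono_le C m n"
proof -
  have h: "m \<in> Hom C (src C m) E" "n \<in> Hom C (src C n) E" using m n by (auto simp: monos_into_iff)
  have z: "zerom C (src C m) (src C n) \<in> Hom C (src C m) (src C n)"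
    by (rule zerom_hom[OF Hom_objs(1)[OF h(1)] Hom_objs(1)[OF h(2)]])
  show ?thesis
    by (rule mono_leI[OF z h trans[OF zero_object_hom(1)[OF m(2) h(1)]
      zero_object_hom(1)[OF m(2) cmp_hom[OF z h(2)], symmetric]]])
qed

text \<open>Monomorphisms with zero source factor through one another, and a monomorphism factoring
  through one of them has zero source. So \<open>sub_bot\<close>, though defined by sources, is a
  single equivalence class.\<close>

lemma sub_bot_eq:
  assumes m: "m \<in> monos_into C E" "zero_object C (src C m)"
  shows "sub_bot C E = subobj_of C m"
proof (intro equalityI subsetI)
  fix n assume "n \<in> sub_bot C E"
  then have n: "n \<in> monos_into C E" "zero_object C (src C n)" by (auto simp: sub_bot_def)
  then show "n \<in> subobj_of C m" using mono_le_of_zero m by (simp add: subobj_of_iff[OF m(1)])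
next
  fix n assume "n \<in> subobj_of C m"
  then have n: "n \<in> monos_into C E" "mono_le C n m" using subobj_of_iff[OF m(1)] by auto
  have mh: "m \<in> Hom C (src C m) E" using m by (auto simp: monos_into_iff)
  obtain u where u: "u \<in> Hom C (src C n) (src C m)" "n = m \<cdot> u"
    by (rule mono_leE[OF n(2) mh])
  have "is_mono C u" using mono_left_factor[OF _ u(1) mh] u(2) n(1) by (simp add: monos_into_iff)
  then show "n \<in> sub_bot C E" using zero_object_mono[OF m(2) u(1)] n(1) by (simp add: sub_bot_def)
qed

end


section \<open>Torsion classes\<close>

definition quot_closed :: "('o, 'm) preadd \<Rightarrow> 'o set \<Rightarrow> bool" where
  "quot_closed C \<Q> \<longleftrightarrow> \<Q> \<subseteq> objs C \<and> (\<forall>X Y. \<forall>e \<in> Hom C X Y. X \<in> \<Q> \<and> is_epi C e \<longrightarrow> Y \<in> \<Q>)"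

text \<open>The clause on zero objects excludes the empty class, which is vacuously closed under
  quotients and extensions.\<close>

definition torsion_class :: "('o, 'm) preadd \<Rightarrow> 'o set \<Rightarrow> bool" where
  "torsion_class C \<T> \<longleftrightarrow> quot_closed C \<T> \<and> ext_closed C \<T> \<and> Collect (zero_object C) \<subseteq> \<T>"

text \<open>Filtrations grown from below, each step adding one factor from \<open>\<Q>\<close> as
  the new top quotient. For quotient-closed \<open>\<Q>\<close> this is the extension closure, now
  with an induction rule.\<close>

inductive_set ext_hull :: "('o, 'm) preadd \<Rightarrow> 'o set \<Rightarrow> 'o set" for C \<Q> where
  zero: "zero_object C E \<Longrightarrow> E \<in> ext_hull C \<Q>"
| step: "short_exact C f g \<Longrightarrow> src C f \<in> ext_hull C \<Q> \<Longrightarrow> tgt C g \<in> \<Q> \<Longrightarrow> tgt C f \<in> ext_hull C \<Q>"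

lemma quot_closedD: "quot_closed C \<Q> \<Longrightarrow> X \<in> \<Q> \<Longrightarrow> e \<in> Hom C X Y \<Longrightarrow> is_epi C e \<Longrightarrow> Y \<in> \<Q>"
  unfolding quot_closed_def by blast

lemma ext_closedD:
  "ext_closed C \<X> \<Longrightarrow> short_exact C f g \<Longrightarrow> src C f \<in> \<X> \<Longrightarrow> tgt C g \<in> \<X> \<Longrightarrow> tgt C f \<in> \<X>"
  unfolding ext_closed_def by blast

context abelian_category
begin

lemma quot_closed_quotients: "quot_closed C (quotients C \<S>)"
  unfolding quot_closed_def using quotients_objs[of \<S>] quotients_epi by blast

text \<open>Quotient closure includes closure under isomorphism. This is how \<open>sub_in\<close>,
  a condition on all representatives, is verified from one of them.\<close>

lemma quot_closed_subobj:
  assumes Q: "quot_closed C \<Q>" and S: "S \<in> subobjs C E" "m \<in> S" "n \<in> S" and m: "src C m \<in> \<Q>"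
  shows "src C n \<in> \<Q>"
proof -
  have h: "is_mono C n" "m \<in> Hom C (src C m) E" "n \<in> Hom C (src C n) E"
    using subobjs_rep(1)[OF S(1,2)] subobjs_rep(1)[OF S(1,3)] by (auto simp: monos_into_iff)
  obtain u where u: "u \<in> Hom C (src C m) (src C n)" "m = n \<cdot> u"
    by (rule mono_leE[OF subobjs_equiv[OF S] h(3)])
  obtain v where v: "v \<in> Hom C (src C n) (src C m)" "n = m \<cdot> v"
    by (rule mono_leE[OF subobjs_equiv[OF S(1,3,2)] h(2)])
  have "is_epi C u" by (rule mono_le_antisym_epi[OF u v h(3,1)])
  then show ?thesis by (rule quot_closedD[OF Q m u(1)])
qed

lemma ext_hull_objs: "E \<in> ext_hull C \<Q> \<Longrightarrow> E \<in> objs C"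
proof (induction rule: ext_hull.induct)
  case (zero E)
  then show ?case by (simp add: zero_object_def)
next
  case (step f g)
  show ?case by (rule Hom_objs(2)[OF short_exact_hom(1)[OF step.hyps(1)]])
qed

text \<open>For an epimorphism \<open>e\<close> out of an extension, the image of the subobject lies
  in the hull by induction, and the cokernel of that image is a quotient of the top factor. So the
  target of \<open>e\<close> is again one step of the hull.\<close>

lemma quot_closed_ext_hull:
  assumes Q: "quot_closed C \<Q>"
  shows "quot_closed C (ext_hull C \<Q>)"
proof -
  have "Y \<in> ext_hull C \<Q>" if "E \<in> ext_hull C \<Q>" "e \<in> Hom C E Y" "is_epi C e" for E Y e
    using that
  proof (induction arbitrary: Y e rule: ext_hull.induct)
    case (zero E)
    show ?case by (rule ext_hull.zero[OF zero_object_epi[OF zero]])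
  next
    case (step f g)
    note h = short_exact_hom[OF step.hyps(1)]
    have ef: "e \<cdot> f \<in> Hom C (src C f) Y" by (rule cmp_hom[OF h(1) step.prems(1)])
    obtain I p m where im: "p \<in> Hom C (src C f) I" "m \<in> Hom C I Y" "e \<cdot> f = m \<cdot> p" "is_epi C p" "is_mono C m"
      by (rule image_factorization[OF ef])
    have I: "I \<in> ext_hull C \<Q>" by (rule step.IH[OF im(1,4)])
    obtain q where q: "short_exact C m q" by (rule short_exact_of_mono[OF im(5)])
    note qh = short_exact_hom[OF q, unfolded HomD(2,3)[OF im(2)]]
    have qe: "q \<cdot> e \<in> Hom C (tgt C f) (tgt C q)" by (rule cmp_hom[OF step.prems(1) qh(2)])
    have "(q \<cdot> e) \<cdot> f = q \<cdot> m \<cdot> p" using cmp_assoc[OF h(1) step.prems(1) qh(2)] im(3) by simp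
    also have "\<dots> = zerom C (src C f) (tgt C q)"
      using cmp_assoc[OF im(1,2) qh(2)] qh(3) zerom_cmp[OF im(1)] Hom_objs[OF qh(2)] by simp
    finally obtain w where w: "w \<in> Hom C (tgt C g) (tgt C q)" "w \<cdot> g = q \<cdot> e"
      by (rule cokernel_factor[OF short_exactD(2)[OF step.hyps(1)] h(1) qe])
    have "is_epi C (w \<cdot> g)" using epi_cmp[OF step.prems(2,1) qh(5,2)] w(2) by simp
    then have "tgt C q \<in> \<Q>" using quot_closedD[OF Q step.hyps(3) w(1)] epi_right_factor[OF _ h(2) w(1)] by simp
    then have "tgt C m \<in> ext_hull C \<Q>" using ext_hull.step[OF q] I HomD(2)[OF im(2)] by simp
    then show ?case using HomD(3)[OF im(2)] by simp
  qed
  moreover have "ext_hull C \<Q> \<subseteq> objs C" by (rule subsetI) (rule ext_hull_objs)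
  ultimately show ?thesis unfolding quot_closed_def by blast
qed

text \<open>Induction on the quotient term, not on the subobject. Removing the top factor of the
  quotient leaves a smaller member of the hull; its preimage is an extension covered by the
  induction hypothesis, and the removed factor is put back on top of it.\<close>

lemma ext_closed_ext_hull:
  assumes Q: "quot_closed C \<Q>"
  shows "ext_closed C (ext_hull C \<Q>)"
proof -
  have "tgt C f \<in> ext_hull C \<Q>"
    if "B \<in> ext_hull C \<Q>" "short_exact C f g" "tgt C g = B" "src C f \<in> ext_hull C \<Q>" for B f g
    using that
  proof (induction arbitrary: f g rule: ext_hull.induct)
    case (zero E)
    note h = short_exact_hom[OF zero.prems(1)]
    have o: "tgt C f \<in> objs C" using Hom_objs[OF h(1)] by simp
    \<comment> \<open>The quotient is zero, so the identity of the middle term factors through the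
      kernel \<open>f\<close>, which makes \<open>f\<close> a split epimorphism.\<close>
    have g0: "g \<cdot> idt C (tgt C f) = zerom C (tgt C f) (tgt C g)"
      using idt_right[OF h(2)] zero_object_hom(2)[OF _ h(2)] zero.hyps zero.prems(2) by simp
    obtain u where u: "u \<in> Hom C (tgt C f) (src C f)" "f \<cdot> u = idt C (tgt C f)"
      by (rule kernel_factor[OF short_exactD(1)[OF zero.prems(1)] h(2) idt_hom[OF o] g0])
    show ?case by (rule quot_closedD[OF quot_closed_ext_hull[OF Q] zero.prems(3) h(1) split_epi[OF h(1) u]])
  next
    case (step b h)
    obtain i c a where x: "short_exact C i (h \<cdot> g)" "short_exact C a c" "f = i \<cdot> a"
      "src C a = src C f" "tgt C a = src C i" "tgt C c = src C b" "tgt C i = tgt C f" "b \<cdot> c = g \<cdot> i"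
      by (rule preimage_exact[OF step.prems(1) step.hyps(1) step.prems(2)])
    have "tgt C a \<in> ext_hull C \<Q>" by (rule step.IH[OF x(2)]) (simp_all add: x(4-7) step.prems)
    then have si: "src C i \<in> ext_hull C \<Q>" by (simp add: x(5))
    have "g \<in> Hom C (tgt C f) (tgt C b)" using short_exact_hom(2)[OF step.prems(1)] step.prems(2) by simp
    then have "tgt C (h \<cdot> g) = tgt C h"
      using HomD(3)[OF cmp_hom[OF _ short_exact_hom(2)[OF step.hyps(1)]]] by simp
    then show ?case using ext_hull.step[OF x(1) si] step.hyps(3) x(7) by simp
  qed
  then show ?thesis unfolding ext_closed_def by blast
qed

text \<open>A filtration with factors in \<open>\<Q>\<close>, given by chosen monomorphisms instead of subobjects.\<close>

definition mono_chain :: "'o set \<Rightarrow> 'o \<Rightarrow> nat \<Rightarrow> (nat \<Rightarrow> 'm) \<Rightarrow> bool" where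
  "mono_chain \<Q> E k m \<longleftrightarrow> (\<forall>i \<le> k. m i \<in> monos_into C E) \<and> zero_object C (src C (m 0)) \<and>
     mono_le C (idt C E) (m k) \<and>
     (\<forall>i < k. \<exists>u \<in> Hom C (src C (m i)) (src C (m (Suc i))). \<exists>q. m i = m (Suc i) \<cdot> u \<and>
        is_cokernel C u q \<and> tgt C q \<in> \<Q>)"

lemma ext_hull_mono_chain:
  assumes Q: "quot_closed C \<Q>" and "E \<in> ext_hull C \<Q>"
  shows "\<exists>k m. mono_chain \<Q> E k m"
  using assms(2)
proof (induction rule: ext_hull.induct)
  case (zero E)
  then have E: "E \<in> objs C" by (simp add: zero_object_def)
  have "mono_chain \<Q> E 0 (\<lambda>_. idt C E)"
    using zero idt_into[OF E] mono_le_refl[OF mono_into_arr[OF idt_into[OF E]]] HomD(2)[OF idt_hom[OF E]]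
    by (simp add: mono_chain_def)
  then show ?case by blast
next
  case (step f g)
  let ?A = "src C f" and ?E = "tgt C f"
  note h = short_exact_hom[OF step.hyps(1)]
  have E: "?A \<in> objs C" "?E \<in> objs C" using Hom_objs[OF h(1)] by auto
  have f: "f \<in> monos_into C ?E" using h by (simp add: monos_into_iff)
  obtain k m where m: "\<And>i. i \<le> k \<Longrightarrow> m i \<in> monos_into C ?A" "zero_object C (src C (m 0))"
    "mono_le C (idt C ?A) (m k)" and link: "\<And>i. i < k \<Longrightarrow>
      \<exists>u \<in> Hom C (src C (m i)) (src C (m (Suc i))). \<exists>q. m i = m (Suc i) \<cdot> u \<and> is_cokernel C u q \<and> tgt C q \<in> \<Q>"
    using step.IH unfolding mono_chain_def by blast
  have mh: "m i \<in> Hom C (src C (m i)) ?A" if "i \<le> k" for i using m(1)[OF that] by (simp add: monos_into_iff)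
  \<comment> \<open>The chain of \<open>?A\<close> is carried into \<open>?E\<close> by
    \<open>f\<close>, and \<open>?E\<close> itself is added at index \<open>k + 1\<close>.\<close>
  let ?m = "\<lambda>i. if i \<le> k then f \<cdot> m i else idt C ?E"
  have into: "f \<cdot> m i \<in> monos_into C ?E" and sm: "src C (f \<cdot> m i) = src C (m i)" if "i \<le> k" for i
    using monos_into_cmp[OF m(1)[OF that] f refl] by auto
  have "\<exists>u \<in> Hom C (src C (?m i)) (src C (?m (Suc i))). \<exists>q. ?m i = ?m (Suc i) \<cdot> u \<and>
        is_cokernel C u q \<and> tgt C q \<in> \<Q>" if i: "i < Suc k" for i
  proof (cases "i < k")
    case True
    obtain u q where u: "u \<in> Hom C (src C (m i)) (src C (m (Suc i)))" "m i = m (Suc i) \<cdot> u"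
      "is_cokernel C u q" "tgt C q \<in> \<Q>" using link[OF True] by blast
    have "f \<cdot> m i = (f \<cdot> m (Suc i)) \<cdot> u" using cmp_assoc[OF u(1) mh h(1)] True u(2) by simp
    then show ?thesis using u(1,3,4) True sm[of i] sm[of "Suc i"] by auto
  next
    case False
    then have i: "i = k" using i by simp
    \<comment> \<open>Since \<open>m k\<close> is only equivalent to the identity of
      \<open>?A\<close>, the new factor need not be \<open>tgt C g\<close> itself. But
      \<open>f\<close> factors through \<open>?u\<close>, so \<open>q\<close> kills \<open>f\<close>
      and factors through \<open>g\<close>: the new factor is a quotient of
      \<open>tgt C g\<close>.\<close>
    let ?u = "f \<cdot> m k"
    have u: "?u \<in> Hom C (src C (m k)) ?E" by (rule cmp_hom[OF mh[OF order_refl] h(1)])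
    obtain q where q: "is_cokernel C ?u q" using ex_cokernel[OF HomD(1)[OF u]] by blast
    note qh = cokernel_hom[OF q u]
    have src_idt: "src C (idt C ?A) = ?A" using HomD(2)[OF idt_hom[OF E(1)]] .
    obtain v where v: "v \<in> Hom C ?A (src C (m k))" "idt C ?A = m k \<cdot> v"
      by (rule mono_leE[OF m(3) mh[OF order_refl], unfolded src_idt])
    have "q \<cdot> f = q \<cdot> f \<cdot> m k \<cdot> v" using v(2) idt_right[OF h(1)] by simp
    also have "\<dots> = (q \<cdot> ?u) \<cdot> v"
      by (simp add: cmp_assoc[OF v(1) u qh(1)] cmp_assoc[OF v(1) mh[OF order_refl] h(1)])
    also have "\<dots> = zerom C ?A (tgt C q)" using qh zerom_cmp[OF v(1)] Hom_objs[OF qh(1)] by simp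
    finally obtain w where w: "w \<in> Hom C (tgt C g) (tgt C q)" "w \<cdot> g = q"
      by (rule cokernel_factor[OF short_exactD(2)[OF step.hyps(1)] h(1) qh(1)])
    have "is_epi C w" using epi_right_factor[OF _ h(2) w(1)] w(2) cokernel_epi[OF q] by simp
    then have "tgt C q \<in> \<Q>" by (rule quot_closedD[OF Q step.hyps(3) w(1)])
    then have "\<exists>v \<in> Hom C (src C (m k)) ?E. \<exists>q. ?u = idt C ?E \<cdot> v \<and> is_cokernel C v q \<and> tgt C q \<in> \<Q>"
      using q idt_left[OF u] by (intro bexI[OF _ u]) auto
    then show ?thesis using i HomD(2)[OF idt_hom[OF E(2)]] sm[of k] by simp
  qed
  then have "mono_chain \<Q> ?E (Suc k) ?m"
    unfolding mono_chain_def using into idt_into[OF E(2)] sm[of 0] m(2) mono_le_refl[OF mono_into_arr[OF idt_into[OF E(2)]]]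
    by auto
  then show ?case by blast
qed

text \<open>\<open>factor_in\<close> ranges over every pair of representatives and every cokernel.
  The comparison \<open>b\<close> from the chosen upper monomorphism to an arbitrary one is epi, so
  it induces an epimorphism from the chosen factor onto the arbitrary one, and quotient closure
  applies.\<close>

lemma mono_chain_bracket:
  assumes E: "E \<in> objs C" and chain: "mono_chain (quotients C \<S>) E k m"
  shows "E \<in> bracket C \<S>"
proof -
  let ?Q = "quotients C \<S>"
  have m: "\<And>i. i \<le> k \<Longrightarrow> m i \<in> monos_into C E" "zero_object C (src C (m 0))" "mono_le C (idt C E) (m k)"
    and link: "\<And>i. i < k \<Longrightarrow> \<exists>u \<in> Hom C (src C (m i)) (src C (m (Suc i))). \<exists>q. m i = m (Suc i) \<cdot> u \<and>
        is_cokernel C u q \<and> tgt C q \<in> ?Q"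
    using chain unfolding mono_chain_def by auto
  define S where "S = (\<lambda>i \<in> {0..k}. subobj_of C (m i))"
  have S: "S i = subobj_of C (m i)" "S i \<in> subobjs C E" "m i \<in> S i" if "i \<le> k" for i
    using that subobj_of_in[OF m(1)] subobj_of_self[OF m(1)] by (auto simp: S_def)
  have le: "sub_le C (S i) (S (Suc i))" if "i < k" for i
  proof -
    obtain u where "u \<in> Hom C (src C (m i)) (src C (m (Suc i)))" "m i = m (Suc i) \<cdot> u" using link[OF \<open>i < k\<close>] by blast
    then have "mono_le C (m i) (m (Suc i))" unfolding mono_le_def by blast
    then show ?thesis using sub_le_iff[of "S i" E "S (Suc i)" "m i" "m (Suc i)"] S that by simp
  qed
  have "sub_chain C E k S"
    unfolding sub_chain_def
  proof (intro conjI ballI)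
    show "S \<in> {0..k} \<rightarrow>\<^sub>E subobjs C E" using S(2) by (auto simp: S_def)
    show "S 0 = sub_bot C E" using sub_bot_eq[OF m(1) m(2)] S(1) by simp
    show "S k = sub_top C E"
      using subobj_of_eqI[OF m(1)[of k] idt_into[OF E] mono_le_idt m(3)] m(1) S(1) by (simp add: sub_top_def)
    fix i assume "i \<in> {1..k}"
    then have "i - 1 < k" "Suc (i - 1) = i" by auto
    then show "sub_le C (S (i - 1)) (S i)" using le[of "i - 1"] by simp
  qed
  moreover have "factor_in C (S i) (S (Suc i)) ?Q" if i: "i < k" for i
    unfolding factor_in_def
  proof (intro ballI allI impI)
    fix n' n u q assume n: "n' \<in> S i" "n \<in> S (Suc i)" and u: "u \<in> Hom C (src C n') (src C n)"
      and nu: "n' = n \<cdot> u \<and> is_cokernel C u q"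
    note qh = cokernel_hom[OF conjunct2[OF nu] u]
    have nh: "is_mono C n" "n \<in> Hom C (src C n) E"
      using subobjs_rep(1)[OF S(2) n(2)] i by (auto simp: monos_into_iff)
    have mh: "m i \<in> Hom C (src C (m i)) E" "m (Suc i) \<in> Hom C (src C (m (Suc i))) E"
      using m(1) i by (simp_all add: monos_into_iff)
    have n'h: "n' \<in> Hom C (src C n') E"
      using subobjs_rep(1)[OF S(2) n(1)] i by (auto simp: monos_into_iff)
    obtain u0 q0 where u0: "u0 \<in> Hom C (src C (m i)) (src C (m (Suc i)))" "m i = m (Suc i) \<cdot> u0"
      "is_cokernel C u0 q0" "tgt C q0 \<in> ?Q" using link[OF i] by blast
    note q0h = cokernel_hom[OF u0(3,1)]
    obtain a where a: "a \<in> Hom C (src C (m i)) (src C n')" "m i = n' \<cdot> a"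
      using mono_leE[OF subobjs_equiv[OF S(2) S(3) n(1)] n'h] i by auto
    obtain b where b: "b \<in> Hom C (src C (m (Suc i))) (src C n)" "m (Suc i) = n \<cdot> b"
      using mono_leE[OF subobjs_equiv[OF S(2) S(3) n(2)] nh(2)] i by auto
    obtain b' where b': "b' \<in> Hom C (src C n) (src C (m (Suc i)))" "n = m (Suc i) \<cdot> b'"
      using mono_leE[OF subobjs_equiv[OF S(2) n(2) S(3)] mh(2)] i by auto
    have epi: "is_epi C b" by (rule mono_le_antisym_epi[OF b b' nh(2,1)])
    have "n \<cdot> b \<cdot> u0 = n \<cdot> u \<cdot> a"
      using cmp_assoc[OF u0(1) b(1) nh(2)] cmp_assoc[OF a(1) u nh(2)] a(2) b(2) u0(2) nu by simp
    then have bu: "b \<cdot> u0 = u \<cdot> a" by (rule monoD[OF nh cmp_hom[OF u0(1) b(1)] cmp_hom[OF a(1) u]])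
    have qb: "q \<cdot> b \<in> Hom C (src C (m (Suc i))) (tgt C q)" by (rule cmp_hom[OF b(1) qh(1)])
    have "(q \<cdot> b) \<cdot> u0 = (q \<cdot> u) \<cdot> a"
      using cmp_assoc[OF u0(1) b(1) qh(1)] cmp_assoc[OF a(1) u qh(1)] bu by simp
    also have "\<dots> = zerom C (src C (m i)) (tgt C q)" using qh zerom_cmp[OF a(1)] Hom_objs[OF qh(1)] by simp
    finally obtain w where w: "w \<in> Hom C (tgt C q0) (tgt C q)" "w \<cdot> q0 = q \<cdot> b"
      by (rule cokernel_factor[OF u0(3,1) qb])
    have "is_epi C (q \<cdot> b)" using epi_cmp[OF epi b(1) cokernel_epi qh(1)] nu by blast
    then have "is_epi C w" using epi_right_factor[OF _ q0h(1) w(1)] w(2) by simp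
    then show "tgt C q \<in> ?Q" by (rule quot_closedD[OF quot_closed_quotients u0(4) w(1)])
  qed
  then have "\<forall>i \<in> {1..k}. factor_in C (S (i - 1)) (S i) ?Q" by (metis Suc_le_eq Suc_pred' atLeastAtMost_iff One_nat_def)
  ultimately show ?thesis using E unfolding bracket_def by blast
qed

text \<open>The exchange of chains for induction. From a chain, one climbs: each member is an
  extension of a factor in \<open>?Q\<close> by the previous member, and the top subobject contains
  the identity of \<open>E\<close>.\<close>

lemma bracket_eq_ext_hull: "bracket C \<S> = ext_hull C (quotients C \<S>)" (is "_ = ext_hull C ?Q")
proof (intro equalityI subsetI)
  fix E assume "E \<in> ext_hull C ?Q"
  then show "E \<in> bracket C \<S>"
    using ext_hull_mono_chain[OF quot_closed_quotients] mono_chain_bracket[OF ext_hull_objs] by blast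
next
  fix E assume "E \<in> bracket C \<S>"
  then obtain k S where E: "E \<in> objs C" and chain: "sub_chain C E k S"
    and fac: "\<forall>i \<in> {1..k}. factor_in C (S (i - 1)) (S i) ?Q" unfolding bracket_def by blast
  have S: "S i \<in> subobjs C E" if "i \<le> k" for i using chain that unfolding sub_chain_def by auto
  have "\<forall>m \<in> S i. src C m \<in> ext_hull C ?Q" if "i \<le> k" for i
    using that
  proof (induction i)
    case 0
    then show ?case using chain by (auto simp: sub_chain_def sub_bot_def intro: ext_hull.zero)
  next
    case (Suc i)
    show ?case
    proof
      fix m assume m: "m \<in> S (Suc i)"
      obtain n where n: "n \<in> monos_into C E" "n \<in> S i" using subobjs_obtain[OF S[of i]] Suc.prems by auto
      have mh: "is_mono C m" "m \<in> Hom C (src C m) E"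
        using subobjs_rep(1)[OF S[OF Suc.prems] m] by (auto simp: monos_into_iff)
      have "sub_le C (S i) (S (Suc i))"
        using bspec[of "{1..k}" "\<lambda>i. sub_le C (S (i - 1)) (S i)" "Suc i"] chain Suc.prems
        unfolding sub_chain_def by simp
      then have le: "mono_le C n m" using sub_le_iff[OF S S n(2) m] Suc.prems by simp
      obtain u where u: "u \<in> Hom C (src C n) (src C m)" "n = m \<cdot> u"
        by (rule mono_leE[OF le mh(2)])
      have "is_mono C u" using mono_left_factor[OF _ u(1) mh(2)] n(1) u(2) by (simp add: monos_into_iff)
      then obtain q where q: "short_exact C u q" by (rule short_exact_of_mono)
      have "factor_in C (S i) (S (Suc i)) ?Q" using bspec[OF fac, of "Suc i"] Suc.prems by simp
      from this[unfolded factor_in_def, rule_format, OF n(2) m u(1) conjI[OF u(2) short_exactD(2)[OF q]]]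
      have "tgt C q \<in> ?Q" .
      moreover have "src C u \<in> ext_hull C ?Q" using Suc n(2) HomD(2)[OF u(1)] by simp
      ultimately have "tgt C u \<in> ext_hull C ?Q" by (intro ext_hull.step[OF q])
      then show "src C m \<in> ext_hull C ?Q" using HomD(3)[OF u(1)] by simp
    qed
  qed
  from this[of k] have "src C (idt C E) \<in> ext_hull C ?Q"
    using chain sub_top_in(2)[OF E] unfolding sub_chain_def by simp
  then show "E \<in> ext_hull C ?Q" using HomD(2)[OF idt_hom[OF E]] by simp
qed

section \<open>The torsion classes that occur: brackets, all objects, zero objects\<close>

lemma torsion_class_bracket: "torsion_class C (bracket C \<S>)"
  unfolding torsion_class_def bracket_eq_ext_hull
  using quot_closed_ext_hull[OF quot_closed_quotients] ext_closed_ext_hull[OF quot_closed_quotients]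
  by (auto intro: ext_hull.zero)

lemma bracket_mono: "\<S> \<subseteq> \<S>' \<Longrightarrow> bracket C \<S> \<subseteq> bracket C \<S>'"
proof
  fix E assume S: "\<S> \<subseteq> \<S>'" and "E \<in> bracket C \<S>"
  then have "E \<in> ext_hull C (quotients C \<S>)" by (simp add: bracket_eq_ext_hull)
  then have "E \<in> ext_hull C (quotients C \<S>')"
  proof (induction rule: ext_hull.induct)
    case (step f g)
    then show ?case using ext_hull.step[OF step.hyps(1) step.IH] S by (auto simp: quotients_def)
  qed (rule ext_hull.zero)
  then show "E \<in> bracket C \<S>'" by (simp add: bracket_eq_ext_hull)
qed

lemma torsion_class_objs: "torsion_class C (objs C)"
proof -
  have "quot_closed C (objs C)" unfolding quot_closed_def using Hom_objs(2) by blast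
  moreover have "ext_closed C (objs C)"
    unfolding ext_closed_def by (intro allI impI) (rule Hom_objs(2)[OF short_exact_hom(1)], erule conjunct1)
  ultimately show ?thesis unfolding torsion_class_def zero_object_def by blast
qed

text \<open>For extensions: a zero kernel makes \<open>g\<close> a monomorphism, and a subobject of
  a zero object is zero.\<close>

lemma torsion_class_zero: "torsion_class C (Collect (zero_object C))"
proof -
  have "zero_object C (tgt C f)" if fg: "short_exact C f g" and z: "zero_object C (src C f)" "zero_object C (tgt C g)" for f g
  proof -
    note h = short_exact_hom[OF fg]
    have "is_mono C g"
    proof (rule mono_trivial_kernelI[OF h(2)])
      fix W x assume x: "x \<in> Hom C W (tgt C f)" "g \<cdot> x = zerom C W (tgt C g)"
      obtain y where y: "y \<in> Hom C W (src C f)" "f \<cdot> y = x"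
        by (rule kernel_factor[OF short_exactD(1)[OF fg] h(2) x])
      show "x = zerom C W (tgt C f)"
        using zero_object_hom(2)[OF z(1) y(1)] y(2) cmp_zerom[OF h(1)] Hom_objs[OF x(1)] by simp
    qed
    then show ?thesis by (rule zero_object_mono[OF z(2) h(2)])
  qed
  then have "ext_closed C (Collect (zero_object C))" unfolding ext_closed_def by blast
  moreover have "quot_closed C (Collect (zero_object C))"
  proof -
    have "Collect (zero_object C) \<subseteq> objs C" by (auto simp: zero_object_def)
    then show ?thesis unfolding quot_closed_def using zero_object_epi by blast
  qed
  ultimately show ?thesis unfolding torsion_class_def by blast
qed

section \<open>Torsion parts in a noetherian abelian category\<close>

lemma torsion_class_objsD: "torsion_class C \<T> \<Longrightarrow> \<T> \<subseteq> objs C"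
  by (auto simp: torsion_class_def quot_closed_def)

text \<open>The larger subobject is the preimage in \<open>E\<close> of the image of \<open>x\<close>.\<close>

lemma torsion_enlarge:
  assumes T: "torsion_class C \<T>" and m: "m \<in> monos_into C E" "src C m \<in> \<T>" and mq: "short_exact C m q"
    and V: "V \<in> \<T>" and x: "x \<in> Hom C V (tgt C q)" "x \<noteq> zerom C V (tgt C q)"
  shows "\<exists>n \<in> monos_into C E. src C n \<in> \<T> \<and> mono_le C m n \<and> \<not> mono_le C n m"
proof -
  have mE: "tgt C m = E" using m(1) by (simp add: monos_into_def)
  note mh = short_exact_hom[OF mq, unfolded mE]
  obtain I e b where im: "e \<in> Hom C V I" "b \<in> Hom C I (tgt C q)" "x = b \<cdot> e" "is_epi C e" "is_mono C b"
    by (rule image_factorization[OF x(1)])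
  obtain h where bh: "short_exact C b h" by (rule short_exact_of_mono[OF im(5)])
  note qb = HomD(3)[OF im(2)]
  obtain i c a where ex: "short_exact C i (h \<cdot> q)" "short_exact C a c" "m = i \<cdot> a"
    "src C a = src C m" "tgt C a = src C i" "tgt C c = src C b" "tgt C i = tgt C m" "b \<cdot> c = q \<cdot> i"
    by (rule preimage_exact[OF mq bh qb[symmetric]])
  have ih: "is_mono C i" "i \<in> Hom C (src C i) E" using short_exact_hom(1,4)[OF ex(1)] ex(7) mE by auto
  have ah: "a \<in> Hom C (src C m) (src C i)" using short_exact_hom(1)[OF ex(2)] ex(4,5) by simp
  have ch: "c \<in> Hom C (src C i) I" "is_epi C c"
    using short_exact_hom(2,5)[OF ex(2)] ex(5,6) HomD(2)[OF im(2)] by auto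
  \<comment> \<open>The image of \<open>x\<close> is a quotient of \<open>V\<close>, and the
    preimage \<open>src C i\<close> is an extension of it by \<open>src C m\<close>; both closure
    properties enter here.\<close>
  have "tgt C c \<in> \<T>"
    using quot_closedD[OF _ V im(1,4)] T ex(6) HomD(2)[OF im(2)] by (simp add: torsion_class_def)
  then have "src C i \<in> \<T>"
    using ext_closedD[OF _ ex(2)] T m(2) ex(4,5) by (simp add: torsion_class_def)
  moreover have "mono_le C m i" by (rule mono_leI[OF ah mh(1) ih(2) ex(3)])
  \<comment> \<open>If \<open>i\<close> factored through \<open>m\<close>, then \<open>q\<close>
    would kill \<open>i\<close>, hence \<open>b \<cdot> c = 0\<close>. As \<open>c\<close> is epi,
    \<open>b\<close> and with it \<open>x\<close> would vanish.\<close>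
  moreover have "\<not> mono_le C i m"
  proof
    assume "mono_le C i m"
    then obtain u where u: "u \<in> Hom C (src C i) (src C m)" "i = m \<cdot> u" by (rule mono_leE[OF _ mh(1)])
    have "b \<cdot> c = q \<cdot> m \<cdot> u" using ex(8) u(2) by simp
    also have "\<dots> = zerom C (src C i) (tgt C q)"
      using cmp_assoc[OF u(1) mh(1,2)] mh(3) zerom_cmp[OF u(1)] Hom_objs[OF mh(2)] by simp
    also have "\<dots> = zerom C I (tgt C q) \<cdot> c" using zerom_cmp[OF ch(1)] Hom_objs[OF mh(2)] by simp
    finally have "b = zerom C I (tgt C q)"
      by (rule epiD[OF ch(2,1) im(2) zerom_hom[OF Hom_objs[OF im(2)]]])
    then have "x = zerom C V (tgt C q)" using im(3) zerom_cmp[OF im(1)] Hom_objs[OF im(2)] by simp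
    then show False using x(2) by simp
  qed
  ultimately show ?thesis using ih by (auto simp: monos_into_iff)
qed

text \<open>Were there no such sequence, \<open>torsion_enlarge\<close> would apply to every torsion
  subobject, and dependent choice starting from the zero subobject would give a strictly ascending
  chain.\<close>

lemma torsion_part:
  assumes noeth: "noetherian C" and T: "torsion_class C \<T>" and E: "E \<in> objs C"
  shows "\<exists>m q. short_exact C m q \<and> tgt C m = E \<and> src C m \<in> \<T> \<and> tgt C q \<in> right_orth C \<T>"
proof (rule ccontr)
  assume none: "\<not> ?thesis"
  let ?P = "\<lambda>m. m \<in> monos_into C E \<and> src C m \<in> \<T>"
  let ?lt = "\<lambda>m n. mono_le C m n \<and> \<not> mono_le C n m"
  have next_mono: "\<exists>n. ?P n \<and> ?lt m n" if m: "?P m" for m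
  proof -
    have mm: "is_mono C m" "tgt C m = E" using m by (auto simp: monos_into_def)
    obtain q where q: "short_exact C m q" by (rule short_exact_of_mono[OF mm(1)])
    have "tgt C q \<notin> right_orth C \<T>" using none q mm(2) m by blast
    then obtain V x where "V \<in> \<T>" "x \<in> Hom C V (tgt C q)" "x \<noteq> zerom C V (tgt C q)"
      using right_orthI[OF Hom_objs(2)[OF short_exact_hom(2)[OF q]] torsion_class_objsD[OF T]] by blast
    then show ?thesis using torsion_enlarge[OF T _ _ q] m by blast
  qed
  obtain N where N: "zero_object C N" using ex_zero by blast
  have z: "zerom C N E \<in> monos_into C E" by (rule zero_mono[OF N E])
  have "src C (zerom C N E) = N" using HomD(2)[OF zerom_hom[OF _ E]] N by (simp add: zero_object_def)
  then have start: "?P (zerom C N E)" using z N T by (auto simp: torsion_class_def)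
  obtain m where m: "\<And>k::nat. ?P (m k)" "\<And>k. ?lt (m k) (m (Suc k))"
    using dependent_nat_choice[of "\<lambda>_. ?P" "\<lambda>_. ?lt"] start next_mono by metis
  define S where "S k = subobj_of C (m k)" for k
  have S: "S k \<in> subobjs C E" "m k \<in> S k" for k
    using m(1)[of k] subobj_of_in subobj_of_self by (auto simp: S_def)
  have "sub_le C (S k) (S (Suc k))" for k
    using sub_le_iff[OF S(1) S(1) S(2) S(2)] m(2) by blast
  then have "\<exists>N. \<forall>k \<ge> N. S k = S N" using noeth E S(1) unfolding noetherian_def by blast
  then obtain K where "S (Suc K) = S K" by (metis le_SucI order_refl)
  then have "m (Suc K) \<in> S K" using S(2)[of "Suc K"] by simp
  then show False using subobjs_equiv[OF S(1) _ S(2), of "m (Suc K)" K] m(2) by blast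
qed

text \<open>Composing with the quotient map gives zero, so \<open>n\<close> factors through the
  kernel. This orders the torsion parts of different classes, identifies the top one with
  \<open>E\<close>, and yields uniqueness.\<close>

lemma torsion_part_greatest:
  assumes n: "n \<in> Hom C V E" and V: "V \<in> \<T>" and m: "short_exact C m q" "tgt C m = E"
    and q: "tgt C q \<in> right_orth C \<T>"
  shows "mono_le C n m"
proof -
  note mh = short_exact_hom[OF m(1), unfolded m(2)]
  have "q \<cdot> n = zerom C V (tgt C q)" by (rule right_orthD[OF q V cmp_hom[OF n mh(2)]])
  then obtain u where u: "u \<in> Hom C V (src C m)" "m \<cdot> u = n"
    by (rule kernel_factor[OF short_exactD(1)[OF m(1)] mh(2) n])
  show ?thesis by (rule mono_leI[OF u(1) n mh(1) u(2)[symmetric]])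
qed

text \<open>Reconciles the convention \<open>F_0 = Z\<close> with the choice of zero objects for
  \<open>T_0\<close>, so that the first step of the filtration has the same form as the
  others.\<close>

lemma right_orth_zero: "right_orth C (Collect (zero_object C)) = objs C"
proof (intro equalityI subsetI)
  fix E assume E: "E \<in> objs C"
  show "E \<in> right_orth C (Collect (zero_object C))"
    by (rule right_orthI[OF E]) (auto simp: zero_object_def[of C] intro: zero_object_hom(1))
qed (simp add: right_orth_def)

lemma torsion_inter_right_orth:
  assumes "torsion_class C \<T>"
  shows "\<T> \<inter> right_orth C \<T> = Collect (zero_object C)"
proof (intro equalityI subsetI)
  fix E assume E: "E \<in> \<T> \<inter> right_orth C \<T>"
  then have o: "E \<in> objs C" using torsion_class_objsD[OF assms] by blast
  then show "E \<in> Collect (zero_object C)"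
    using right_orthD[OF IntD2[OF E] IntD1[OF E] idt_hom[OF o]] o by (simp add: zero_object_iff)
next
  fix E assume "E \<in> Collect (zero_object C)"
  then have E: "zero_object C E" "E \<in> objs C" by (auto simp: zero_object_def)
  then show "E \<in> \<T> \<inter> right_orth C \<T>"
    using assms right_orthI[OF E(2) torsion_class_objsD[OF assms] zero_object_hom(2)[OF E(1)]]
    by (auto simp: torsion_class_def)
qed

section \<open>The filtration attached to a chain of torsion classes, and its strata\<close>

lemma ext_closed_Int: "ext_closed C \<X> \<Longrightarrow> ext_closed C \<Y> \<Longrightarrow> ext_closed C (\<X> \<inter> \<Y>)"
  unfolding ext_closed_def by blast

text \<open>Let \<open>n\<close> represent the common subobject at \<open>Suc j\<close>. Inside
  \<open>src C n\<close>, the member \<open>S j\<close> is torsion for \<open>T j\<close>, while the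
  quotient by \<open>S' j\<close> admits no nonzero maps from \<open>T j\<close>; so
  \<open>S j\<close> lies below \<open>S' j\<close>. Torsion of one chain meets torsion-freeness of
  the other, so exchanging the chains gives equality.\<close>

lemma torsion_filtration_le:
  assumes S: "sub_chain C E N S" and S': "sub_chain C E N S'"
    and in_T: "\<And>j. 1 \<le> j \<Longrightarrow> j < N \<Longrightarrow> sub_in C (S j) (T j)"
    and fac: "\<And>j. 1 \<le> j \<Longrightarrow> j < N \<Longrightarrow> factor_in C (S' j) (S' (Suc j)) (right_orth C (T j))"
    and j: "1 \<le> j" "j < N" and eq: "S (Suc j) = S' (Suc j)" and m: "m \<in> S j" "m' \<in> S' j"
  shows "mono_le C m m'"
proof -
  have sub: "S i \<in> subobjs C E" "S' i \<in> subobjs C E" if "i \<le> N" for i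
    using S S' that unfolding sub_chain_def by auto
  have le: "sub_le C (S j) (S (Suc j))" "sub_le C (S' j) (S' (Suc j))"
    using S S' j bspec[of "{1..N}" "\<lambda>i. sub_le C (S (i - 1)) (S i)" "Suc j"]
      bspec[of "{1..N}" "\<lambda>i. sub_le C (S' (i - 1)) (S' i)" "Suc j"]
    unfolding sub_chain_def by auto
  obtain n where n: "n \<in> monos_into C E" "n \<in> S (Suc j)" using subobjs_obtain[OF sub(1)[of "Suc j"]] j by auto
  have n': "n \<in> S' (Suc j)" using n eq by simp
  have nh: "n \<in> Hom C (src C n) E" using n(1) by (simp add: monos_into_iff)
  have "mono_le C m n" "mono_le C m' n"
    using sub_le_iff[OF sub(1) sub(1) m(1) n(2)] sub_le_iff[OF sub(2) sub(2) m(2) n'] le j by auto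
  then obtain u u' where u: "u \<in> Hom C (src C m) (src C n)" "m = n \<cdot> u" "m \<in> Hom C (src C m) E"
    and u': "u' \<in> Hom C (src C m') (src C n)" "m' = n \<cdot> u'" "m' \<in> Hom C (src C m') E"
    by (meson mono_leE nh)
  have m': "m' \<in> monos_into C E" using subobjs_rep(1)[OF sub(2) m(2)] j by simp
  have "is_mono C u'" using mono_left_factor[OF _ u'(1) nh] u'(2) m' by (simp add: monos_into_iff)
  then obtain q where q: "short_exact C u' q" by (rule short_exact_of_mono)
  have "tgt C q \<in> right_orth C (T j)"
    by (rule fac[OF j, unfolded factor_in_def, rule_format, OF m(2) n' u'(1) conjI[OF u'(2) short_exactD(2)[OF q]]])
  moreover have "src C m \<in> T j" using in_T[OF j] m(1) unfolding sub_in_def by blast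
  ultimately have uu': "mono_le C u u'" using torsion_part_greatest[OF u(1) _ q HomD(3)[OF u'(1)]] by blast
  obtain v where v: "v \<in> Hom C (src C m) (src C m')" "u = u' \<cdot> v"
    by (rule mono_leE[OF uu' u'(1), unfolded HomD(2)[OF u(1)]])
  have "m = n \<cdot> u' \<cdot> v" using u(2) v(2) by simp
  also have "\<dots> = m' \<cdot> v" using cmp_assoc[OF v(1) u'(1) nh] u'(2) by simp
  finally have "m = m' \<cdot> v" .
  then show ?thesis by (rule mono_leI[OF v(1) u(3) u'(3)])
qed

text \<open>For existence, the factor \<open>E_{i+1}/E_i\<close> is a quotient of
  \<open>E_{i+1}\<close>, hence in \<open>T (Suc i)\<close>, and it embeds into
  \<open>E/E_i\<close>, hence is right orthogonal to \<open>T i\<close>.\<close>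

lemma torsion_filtration:
  fixes T :: "nat \<Rightarrow> 'o set"
  assumes noeth: "noetherian C" and T: "\<And>i. i \<le> N \<Longrightarrow> torsion_class C (T i)"
    and T_mono: "\<And>i. i < N \<Longrightarrow> T i \<subseteq> T (Suc i)"
    and T_0: "T 0 = Collect (zero_object C)" and T_N: "T N = objs C" and E: "E \<in> objs C"
  shows "\<exists>!S. sub_chain C E N S \<and> (\<forall>i \<in> {1..N}. sub_in C (S i) (T i) \<and>
    factor_in C (S (i - 1)) (S i) (T i \<inter> right_orth C (T (i - 1))))"
    (is "\<exists>!S. ?F S")
proof (rule ex_ex1I)
  \<comment> \<open>The bound sits inside the existential so that torsion parts can be chosen for
    all indices at once.\<close>
  have "\<exists>m q. i \<le> N \<longrightarrow> short_exact C m q \<and> tgt C m = E \<and> src C m \<in> T i \<and> tgt C q \<in> right_orth C (T i)" for i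
    using torsion_part[OF noeth T E] by blast
  then obtain m q where mq: "\<And>i. i \<le> N \<Longrightarrow> short_exact C (m i) (q i)" "\<And>i. i \<le> N \<Longrightarrow> tgt C (m i) = E"
    "\<And>i. i \<le> N \<Longrightarrow> src C (m i) \<in> T i" "\<And>i. i \<le> N \<Longrightarrow> tgt C (q i) \<in> right_orth C (T i)"
    by metis
  have mh: "m i \<in> Hom C (src C (m i)) E" "is_mono C (m i)" if "i \<le> N" for i
    using short_exact_hom(1,4)[OF mq(1)[OF that]] mq(2)[OF that] by auto
  have into: "m i \<in> monos_into C E" if "i \<le> N" for i using mh[OF that] by (simp add: monos_into_iff)
  define S where "S = (\<lambda>i \<in> {0..N}. subobj_of C (m i))"
  have S: "S i = subobj_of C (m i)" "S i \<in> subobjs C E" "m i \<in> S i" if "i \<le> N" for i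
    using that subobj_of_in[OF into] subobj_of_self[OF into] by (auto simp: S_def)
  have src_T: "src C n \<in> T i" if "i \<le> N" "n \<in> S i" for i n
    using quot_closed_subobj[OF _ S(2)[OF that(1)] S(3)[OF that(1)] that(2) mq(3)[OF that(1)]] T[OF that(1)]
    by (simp add: torsion_class_def)
  have le: "sub_le C (S i) (S (Suc i))" if "i < N" for i
  proof -
    have i: "i \<le> N" "Suc i \<le> N" using that by auto
    have "src C (m i) \<in> T (Suc i)" using mq(3)[OF i(1)] T_mono[OF that] by blast
    then have "mono_le C (m i) (m (Suc i))"
      by (rule torsion_part_greatest[OF mh(1)[OF i(1)] _ mq(1,2,4)[OF i(2)]])
    then show ?thesis using sub_le_iff[OF S(2)[OF i(1)] S(2)[OF i(2)] S(3)[OF i(1)] S(3)[OF i(2)]] by blast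
  qed
  have "sub_chain C E N S"
    unfolding sub_chain_def
  proof (intro conjI ballI)
    show "S \<in> {0..N} \<rightarrow>\<^sub>E subobjs C E" using S(2) by (auto simp: S_def)
    show "S 0 = sub_bot C E" using sub_bot_eq[OF into, of 0] mq(3)[of 0] T_0 S(1)[of 0] by simp
    have "mono_le C (idt C E) (m N)"
      by (rule torsion_part_greatest[OF idt_hom[OF E] _ mq(1,2,4)]) (simp_all add: T_N E)
    then show "S N = sub_top C E"
      using subobj_of_eqI[OF into idt_into[OF E] mono_le_idt[OF into]] S(1) by (simp add: sub_top_def)
    fix i assume "i \<in> {1..N}"
    then have "i - 1 < N" "Suc (i - 1) = i" by auto
    then show "sub_le C (S (i - 1)) (S i)" using le[of "i - 1"] by simp
  qed
  moreover have "sub_in C (S i) (T i)" if "i \<le> N" for i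
    unfolding sub_in_def using src_T[OF that] by blast
  moreover have "factor_in C (S i) (S (Suc i)) (T (Suc i) \<inter> right_orth C (T i))" if "i < N" for i
    unfolding factor_in_def
  proof (intro ballI allI impI)
    have i: "i \<le> N" "Suc i \<le> N" using that by auto
    fix n' n u r assume n: "n' \<in> S i" "n \<in> S (Suc i)" and u: "u \<in> Hom C (src C n') (src C n)"
      and nu: "n' = n \<cdot> u \<and> is_cokernel C u r"
    note rh = cokernel_hom(1)[OF conjunct2[OF nu] u]
    have nh: "n \<in> Hom C (src C n) E" "is_mono C n"
      using subobjs_rep(1)[OF S(2)[OF i(2)] n(2)] by (auto simp: monos_into_iff)
    have n'm: "is_mono C (n \<cdot> u)"
      using subobjs_rep(1)[OF S(2)[OF i(1)] n(1)] nu by (auto simp: monos_into_iff)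
    have eqv: "mono_le C (m i) (n \<cdot> u)" "mono_le C (n \<cdot> u) (m i)"
      using subobjs_equiv[OF S(2)[OF i(1)] S(3)[OF i(1)] n(1)]
        subobjs_equiv[OF S(2)[OF i(1)] n(1) S(3)[OF i(1)]] nu by auto
    obtain w where w: "w \<in> Hom C (tgt C r) (tgt C (q i))" "is_mono C w"
      by (rule quotient_embedding[OF nh u n'm conjunct2[OF nu] mq(1,2)[OF i(1)] eqv])
    have "tgt C r \<in> T (Suc i)"
      using quot_closedD[OF _ src_T[OF i(2) n(2)] rh] cokernel_epi nu T[OF i(2)] by (auto simp: torsion_class_def)
    moreover have "tgt C r \<in> right_orth C (T i)"
    proof (rule right_orthI[OF Hom_objs(2)[OF rh] torsion_class_objsD[OF T[OF i(1)]]])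
      fix V x assume V: "V \<in> T i" and x: "x \<in> Hom C V (tgt C r)"
      note Vo = Hom_objs(1)[OF x]
      \<comment> \<open>Right orthogonality passes to subobjects, here along the embedding
        \<open>w\<close> of \<open>E_{i+1}/E_i\<close> into \<open>E/E_i\<close>.\<close>
      have "w \<cdot> x = zerom C V (tgt C (q i))" by (rule right_orthD[OF mq(4)[OF i(1)] V cmp_hom[OF x w(1)]])
      also have "\<dots> = w \<cdot> zerom C V (tgt C r)" by (rule cmp_zerom[OF w(1) Vo, symmetric])
      finally show "x = zerom C V (tgt C r)" by (rule monoD[OF w(2,1) x zerom_hom[OF Hom_objs[OF x]]])
    qed
    ultimately show "tgt C r \<in> T (Suc i) \<inter> right_orth C (T i)" by blast
  qed
  then have "factor_in C (S (i - 1)) (S i) (T i \<inter> right_orth C (T (i - 1)))" if "i \<in> {1..N}" for i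
    using that by (cases i) auto
  ultimately show "\<exists>S. ?F S" by (intro exI[of _ S]) simp
next
  fix S S' assume F: "?F S" "?F S'"
  have sub: "S i \<in> subobjs C E" "S' i \<in> subobjs C E" if "i \<le> N" for i
    using F that unfolding sub_chain_def by auto
  have in_T: "sub_in C (S j) (T j)" "sub_in C (S' j) (T j)" if "1 \<le> j" "j < N" for j using F that by auto
  \<comment> \<open>Orthogonality to \<open>T j\<close> is part of the factor condition at index
    \<open>Suc j\<close>, not at \<open>j\<close>.\<close>
  have "factor_in C (S (Suc j - 1)) (S (Suc j)) (T (Suc j) \<inter> right_orth C (T (Suc j - 1))) \<and>
      factor_in C (S' (Suc j - 1)) (S' (Suc j)) (T (Suc j) \<inter> right_orth C (T (Suc j - 1)))"
    if "1 \<le> j" "j < N" for j using F that by (intro conjI) (elim conjE ballE[of _ _ "Suc j"], simp_all)+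
  then have fac: "factor_in C (S j) (S (Suc j)) (right_orth C (T j))"
    "factor_in C (S' j) (S' (Suc j)) (right_orth C (T j))" if "1 \<le> j" "j < N" for j
    using that by (auto simp: factor_in_def)
  have "S j = S' j" if "j \<le> N" for j
    using that
  proof (induction rule: inc_induct)
    case base
    show ?case using F by (simp add: sub_chain_def)
  next
    case (step j)
    show ?case
    \<comment> \<open>Index \<open>0\<close> is settled by the chain condition; the torsion
      conditions only start at index \<open>1\<close>.\<close>
    proof (cases "j = 0")
      case True
      then show ?thesis using F by (simp add: sub_chain_def)
    next
      case False
      then have j: "1 \<le> j" "j < N" using step by auto
      obtain m where m: "m \<in> monos_into C E" "m \<in> S j" "S j = subobj_of C m"
        using j by (auto intro: subobjs_obtain[OF sub(1)[of j]])
      obtain m' where m': "m' \<in> monos_into C E" "m' \<in> S' j" "S' j = subobj_of C m'"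
        using j by (auto intro: subobjs_obtain[OF sub(2)[of j]])
      have "mono_le C m m'"
        by (rule torsion_filtration_le[OF conjunct1[OF F(1)] conjunct1[OF F(2)] in_T(1) fac(2) j step.IH m(2) m'(2)])
      moreover have "mono_le C m' m"
        by (rule torsion_filtration_le[OF conjunct1[OF F(2)] conjunct1[OF F(1)] in_T(2) fac(1) j step.IH[symmetric] m'(2) m(2)])
      ultimately show ?thesis unfolding m(3) m'(3) by (rule subobj_of_eqI[OF m(1) m'(1)])
    qed
  qed
  \<comment> \<open>Outside \<open>{0..N}\<close> the two functions agree by extensionality.\<close>
  then show "S = S'" using F unfolding sub_chain_def by (intro PiE_ext[of S "{0..N}" "\<lambda>_. subobjs C E" S']) auto
qed

text \<open>For \<open>i < j\<close> the class \<open>T i\<close> is contained in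
  \<open>T (j - 1)\<close>, so a common object lies in \<open>T (j - 1)\<close> and in its right
  orthogonal.\<close>

lemma torsion_strata_disjoint:
  assumes T: "\<And>i. i \<le> N \<Longrightarrow> torsion_class C (T i)" and T_mono: "\<And>i. i < N \<Longrightarrow> T i \<subseteq> T (Suc i)"
    and ij: "1 \<le> i" "i < j" "j \<le> N"
  shows "(T i \<inter> right_orth C (T (i - 1))) \<inter> (T j \<inter> right_orth C (T (j - 1))) = Collect (zero_object C)"
proof -
  have "T i \<subseteq> T k" if "i \<le> k" "k \<le> N" for k
    using that
  proof (induction rule: dec_induct)
    case (step n)
    then show ?case using T_mono[of n] by auto
  qed simp
  then have "T i \<subseteq> T (j - 1)" using ij by simp
  then have "(T i \<inter> right_orth C (T (i - 1))) \<inter> (T j \<inter> right_orth C (T (j - 1))) \<subseteq> Collect (zero_object C)"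
    using torsion_inter_right_orth[OF T[of "j - 1"]] ij by fastforce
  moreover have "Collect (zero_object C) \<subseteq> T k \<inter> right_orth C (T k')" if "k \<le> N" "k' \<le> N" for k k'
    using torsion_inter_right_orth[OF T[OF that(2)]] T[OF that(1)] by (auto simp: torsion_class_def)
  ultimately show ?thesis using ij by (intro equalityI) auto
qed

end

section \<open>Application to the classes defined by the tilting object\<close>

theorem theorem5p3:
  fixes Z :: "('o, 'm) preadd" and T :: 'o and n :: nat and \<Phi> :: "('o, 'm) tilt_ftor"
  assumes "abelian_category Z" and "noetherian Z" and "homological_dimension Z n"
    and "tilting_object Z T" and "is_RHom Z T \<Phi>"
  shows "(\<forall>E \<in> objs Z. \<exists>!S. sub_chain Z E (n + 1) S \<and>
            (\<forall>i \<in> {1..n + 1}. sub_in Z (S i) (T_cls Z T \<Phi> n i) \<and>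
               factor_in Z (S (i - 1)) (S i) (T_cls Z T \<Phi> n i \<inter> F_cls Z T \<Phi> n (i - 1)))) \<and>
         (\<forall>i \<in> {1..n + 1}. ext_closed Z (T_cls Z T \<Phi> n i \<inter> F_cls Z T \<Phi> n (i - 1))) \<and>
         (\<forall>i \<in> {1..n + 1}. \<forall>j \<in> {1..n + 1}. i \<noteq> j \<longrightarrow>
            (T_cls Z T \<Phi> n i \<inter> F_cls Z T \<Phi> n (i - 1)) \<inter> (T_cls Z T \<Phi> n j \<inter> F_cls Z T \<Phi> n (j - 1))
              = Collect (zero_object Z))"
proof -
  interpret abelian_category Z by (rule assms(1))
  \<comment> \<open>At index \<open>0\<close> the formula of \<open>T_cls\<close> would give a
    bracket; zero objects take its place, so that the right orthogonal there is all of
    \<open>Z\<close>.\<close>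
  define \<T> where "\<T> i = (if i = 0 then Collect (zero_object Z) else T_cls Z T \<Phi> n i)" for i
  have tors: "torsion_class Z (\<T> i)" for i
    by (simp add: \<T>_def T_cls_def torsion_class_zero torsion_class_objs torsion_class_bracket)
  \<comment> \<open>Dropping the condition at \<open>i\<close> enlarges the bracket. The indices
    \<open>0\<close> and \<open>n\<close> are treated apart because \<open>\<T> 0\<close> and
    \<open>\<T> (n + 1)\<close> are not given as brackets.\<close>
  have mono: "\<T> i \<subseteq> \<T> (Suc i)" if "i < n + 1" for i
  proof (cases "i = 0")
    case True
    then show ?thesis using tors[of 1] by (simp add: \<T>_def torsion_class_def)
  next
    case False
    show ?thesis
    proof (cases "i = n")
      case True
      then show ?thesis using torsion_class_objsD[OF tors[of n]] False by (simp add: \<T>_def T_cls_def)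
    next
      case neq: False
      let ?B = "\<lambda>j. bracket Z (\<Inter>k \<in> {j..n}. B_cls Z T \<Phi> (int k))"
      have "\<T> i = ?B i" "\<T> (Suc i) = ?B (Suc i)"
        using neq False that by (simp_all add: \<T>_def T_cls_def)
      moreover have "?B i \<subseteq> ?B (Suc i)" by (rule bracket_mono) (rule INT_anti_mono, simp_all)
      ultimately show ?thesis by simp
    qed
  qed
  have T_0: "\<T> 0 = Collect (zero_object Z)" and T_N: "\<T> (n + 1) = objs Z"
    by (simp_all add: \<T>_def T_cls_def)
  \<comment> \<open>Here \<open>i - 1\<close> runs through \<open>{0..n}\<close>, so
    \<open>F_cls\<close> is a right orthogonal by definition, except at \<open>0\<close>, where
    \<open>right_orth_zero\<close> makes it one.\<close>
  have T_eq: "T_cls Z T \<Phi> n i = \<T> i" and F_eq: "F_cls Z T \<Phi> n (i - 1) = right_orth Z (\<T> (i - 1))"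
    if "i \<in> {1..n + 1}" for i
    using that by (auto simp: \<T>_def F_cls_def right_orth_zero)
  have strata: "T_cls Z T \<Phi> n i \<inter> F_cls Z T \<Phi> n (i - 1) = \<T> i \<inter> right_orth Z (\<T> (i - 1))"
    if "i \<in> {1..n + 1}" for i
    using T_eq[OF that] F_eq[OF that] by simp
  have "\<exists>!S. sub_chain Z E (n + 1) S \<and> (\<forall>i \<in> {1..n + 1}. sub_in Z (S i) (T_cls Z T \<Phi> n i) \<and>
      factor_in Z (S (i - 1)) (S i) (T_cls Z T \<Phi> n i \<inter> F_cls Z T \<Phi> n (i - 1)))" if E: "E \<in> objs Z" for E
  proof -
    have "\<exists>!S. sub_chain Z E (n + 1) S \<and> (\<forall>i \<in> {1..n + 1}. sub_in Z (S i) (\<T> i) \<and>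
        factor_in Z (S (i - 1)) (S i) (\<T> i \<inter> right_orth Z (\<T> (i - 1))))"
      by (rule torsion_filtration[OF assms(2) tors mono T_0 T_N E])
    then show ?thesis by (simp only: T_eq F_eq cong: ball_cong)
  qed
  moreover have "ext_closed Z (T_cls Z T \<Phi> n i \<inter> F_cls Z T \<Phi> n (i - 1))" if "i \<in> {1..n + 1}" for i
    unfolding strata[OF that] using tors[of i] ext_closed_right_orth[OF torsion_class_objsD[OF tors]]
    by (intro ext_closed_Int) (simp_all add: torsion_class_def)
  moreover have "(T_cls Z T \<Phi> n i \<inter> F_cls Z T \<Phi> n (i - 1)) \<inter> (T_cls Z T \<Phi> n j \<inter> F_cls Z T \<Phi> n (j - 1))
      = Collect (zero_object Z)" if i: "i \<in> {1..n + 1}" and j: "j \<in> {1..n + 1}" and "i \<noteq> j" for i j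
    unfolding strata[OF i] strata[OF j]
  proof (cases "i < j")
    case True
    then show "(\<T> i \<inter> right_orth Z (\<T> (i - 1))) \<inter> (\<T> j \<inter> right_orth Z (\<T> (j - 1))) = Collect (zero_object Z)"
      using i j by (intro torsion_strata_disjoint[where N = "n + 1" and T = \<T>] tors mono) auto
  next
    case False
    then have "(\<T> j \<inter> right_orth Z (\<T> (j - 1))) \<inter> (\<T> i \<inter> right_orth Z (\<T> (i - 1))) = Collect (zero_object Z)"
      using i j \<open>i \<noteq> j\<close> by (intro torsion_strata_disjoint[where N = "n + 1" and T = \<T>] tors mono) auto
    then show "(\<T> i \<inter> right_orth Z (\<T> (i - 1))) \<inter> (\<T> j \<inter> right_orth Z (\<T> (j - 1))) = Collect (zero_object Z)"
      by (simp only: Int_commute)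
  qed
  ultimately show ?thesis by blast
qed

end
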